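(* Let $H$ be a fixed connected simple undirected graph with vertex set $[k]$, and let $\mathit{tw}(H)$ denote its treewidth. For $n \ge 1$, let $\mathrm{Hom}_{H,n}$ be the homomorphism polynomial of $H$ (defined in the context). Then the minimum size of a monotone arithmetic circuit computing $\mathrm{Hom}_{H,n}$ is $\Theta\bigl(n^{\mathit{tw}(H)+1}\bigr)$ as $n \to \infty$, where the constants hidden in $\Theta$ may depend on $H$.
   Context: A homomorphism from a graph $H$ to a graph $G$ is a map $\phi:V(H)\to V(G)$ such that $\{i,j\}\in E(H)$ implies $\{\phi(i),\phi(j)\}\in E(G)$; for an edge $e=\{i,j\}$ write $\phi(e)=\{\phi(i),\phi(j)\}$. The homomorphism polynomial $\mathrm{Hom}_{H,n}$ is the polynomial over $\mathbb{Q}$ in the $\binom n2$ variables $x_{\{u,v\}}$ ($u\neq v\in[n]$) given by $\mathrm{Hom}_{H,n}=\sum_{\phi}\prod_{e\in E(H)} x_{\phi(e)}$, where $\phi$ ranges over all homomorphisms from $H$ to the complete graph $K_n$ on $[n]$. An arithmetic circuit is a rooted DAG whose sources are labeled by variables or constants in $\mathbb{Q}$ and whose other nodes are $+$ or $\times$ gates; it is monotone if all constants are non-negative; its size is its number of edges. A tree decomposition of $H$ is a tree whose nodes (bags) are subsets of $V(H)$ such that every edge of $H$ is contained in some bag and, for every vertex $i$, the bags containing $i$ induce a subtree; its width is the maximum bag size minus one, and $\mathit{tw}(H)$ is the minimum width of a tree decomposition of $H$.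
   Formalization: The formal theorem assumes k ≥ 2: for k = 1 the polynomial is the constant n, computed by a single source with no edges, so the minimum size is 0 and the claimed Θ(n) fails. *)

theory Defs
  imports
    Complex_Main
    "HOL-Library.FuncSet"
    "HOL-Library.Poly_Mapping"
    "HOL-Library.Landau_Symbols"
    "Graph_Theory.Digraph"
begin

section \<open>Simple undirected graphs\<close>

text \<open>
  The edges of an undirected graph are two-element sets of vertices. Graphs and trees are not
  taken from the digraph library: it models undirected graphs by symmetric digraphs, in which
  every edge is a directed 2-cycle, so that its notion of tree does not apply.
\<close>

definition simple_graph :: "'a set \<Rightarrow> 'a set set \<Rightarrow> bool" where
  "simple_graph V E \<longleftrightarrow> (\<forall>e\<in>E. e \<subseteq> V \<and> card e = 2)"

definition complete_edges :: "'a set \<Rightarrow> 'a set set" where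
  "complete_edges V = {{u, v} | u v. u \<in> V \<and> v \<in> V \<and> u \<noteq> v}"

definition connected_graph :: "'a set \<Rightarrow> 'a set set \<Rightarrow> bool" where
  "connected_graph V E \<longleftrightarrow> V \<noteq> {} \<and> (\<forall>u\<in>V. \<forall>v\<in>V. (u, v) \<in> {(a, b). {a, b} \<in> E}\<^sup>*)"

definition is_cycle :: "'a set set \<Rightarrow> 'a list \<Rightarrow> bool" where
  "is_cycle E vs \<longleftrightarrow> 3 \<le> length vs \<and> distinct vs \<and>
     (\<forall>i<length vs. {vs ! i, vs ! (Suc i mod length vs)} \<in> E)"

definition is_tree :: "'a set \<Rightarrow> 'a set set \<Rightarrow> bool" where
  "is_tree V E \<longleftrightarrow> simple_graph V E \<and> connected_graph V E \<and> (\<nexists>vs. is_cycle E vs)"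

definition induced_edges :: "'a set set \<Rightarrow> 'a set \<Rightarrow> 'a set set" where
  "induced_edges E W = {e \<in> E. e \<subseteq> W}"


section \<open>Treewidth\<close>

text \<open>
  The nodes of the tree are the bags themselves, \<^term>\<open>B\<close> is the set of bags and \<^term>\<open>F\<close> the
  set of edges of the tree. As trees are nonempty, every vertex lies in some bag.
\<close>

definition tree_decomposition ::
    "'a set \<Rightarrow> 'a set set \<Rightarrow> 'a set set \<Rightarrow> 'a set set set \<Rightarrow> bool" where
  "tree_decomposition V E B F \<longleftrightarrow>
     is_tree B F \<and>
     (\<forall>b\<in>B. b \<subseteq> V) \<and>
     (\<forall>e\<in>E. \<exists>b\<in>B. e \<subseteq> b) \<and>
     (\<forall>i\<in>V. is_tree {b \<in> B. i \<in> b} (induced_edges F {b \<in> B. i \<in> b}))"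

text \<open>
  For a finite nonempty vertex set some bag is nonempty, so the subtraction does not truncate.
\<close>

definition decomposition_width :: "'a set set \<Rightarrow> nat" where
  "decomposition_width B = Max (card ` B) - 1"

definition treewidth :: "'a set \<Rightarrow> 'a set set \<Rightarrow> nat" where
  "treewidth V E = (LEAST w. \<exists>B F. tree_decomposition V E B F \<and> w = decomposition_width B)"


section \<open>Multivariate polynomials over the rationals\<close>

text \<open>
  A monomial is a finitely supported map from variables to exponents, a polynomial a finitely
  supported map from monomials to coefficients; the ring operations are those of
  the theory \<^theory>\<open>HOL-Library.Poly_Mapping\<close>.
\<close>

type_synonym 'v qpoly = "('v \<Rightarrow>\<^sub>0 nat) \<Rightarrow>\<^sub>0 rat"

definition poly_var :: "'v \<Rightarrow> 'v qpoly" where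
  "poly_var x = Poly_Mapping.single (Poly_Mapping.single x 1) 1"

definition poly_const :: "rat \<Rightarrow> 'v qpoly" where
  "poly_const c = Poly_Mapping.single 0 c"


section \<open>Homomorphism polynomials\<close>

text \<open>Maps are extensional outside \<^term>\<open>V\<close>, so that each homomorphism occurs once.\<close>

definition graph_homs ::
    "'a set \<Rightarrow> 'a set set \<Rightarrow> 'b set \<Rightarrow> 'b set set \<Rightarrow> ('a \<Rightarrow> 'b) set" where
  "graph_homs V E V' E' =
     {\<phi> \<in> V \<rightarrow>\<^sub>E V'. \<forall>i j. {i, j} \<in> E \<longrightarrow> {\<phi> i, \<phi> j} \<in> E'}"

definition hom_poly :: "'a set \<Rightarrow> 'a set set \<Rightarrow> nat \<Rightarrow> nat set qpoly" where
  "hom_poly V E n =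
     (\<Sum>\<phi> \<in> graph_homs V E {1..n} (complete_edges {1..n}). \<Prod>e\<in>E. poly_var (\<phi> ` e))"


section \<open>Arithmetic circuits\<close>

datatype 'v gate = Var 'v | Const rat | Plus | Times

text \<open>
  Arcs point from the inputs of a gate to the gate. Fan-in is unbounded, and parallel arcs are
  allowed so that a gate may use the same input several times.
\<close>

record 'v circuit =
  circ_dag :: "(nat, nat) pre_digraph"
  circ_root :: nat
  circ_gate :: "nat \<Rightarrow> 'v gate"

definition circuit :: "'v set \<Rightarrow> 'v circuit \<Rightarrow> bool" where
  "circuit X C \<longleftrightarrow>
     fin_digraph (circ_dag C) \<and>
     acyclic (arcs_ends (circ_dag C)) \<and>
     circ_root C \<in> verts (circ_dag C) \<and>
     (\<forall>v\<in>verts (circ_dag C). v \<rightarrow>\<^sup>*\<^bsub>circ_dag C\<^esub> circ_root C) \<and>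
     (\<forall>v\<in>verts (circ_dag C).
        if in_arcs (circ_dag C) v = {}
        then circ_gate C v \<in> Var ` X \<union> range Const
        else circ_gate C v \<in> {Plus, Times})"

definition monotone_circuit :: "'v circuit \<Rightarrow> bool" where
  "monotone_circuit C \<longleftrightarrow> (\<forall>v\<in>verts (circ_dag C). \<forall>c. circ_gate C v = Const c \<longrightarrow> 0 \<le> c)"

definition circuit_size :: "'v circuit \<Rightarrow> nat" where
  "circuit_size C = card (arcs (circ_dag C))"

definition gate_value ::
    "'v circuit \<Rightarrow> (nat \<Rightarrow> 'v qpoly) \<Rightarrow> nat \<Rightarrow> 'v qpoly" where
  "gate_value C val v =
     (case circ_gate C v of
        Var x \<Rightarrow> poly_var x
      | Const c \<Rightarrow> poly_const c
      | Plus \<Rightarrow> (\<Sum>a\<in>in_arcs (circ_dag C) v. val (tail (circ_dag C) a))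
      | Times \<Rightarrow> (\<Prod>a\<in>in_arcs (circ_dag C) v. val (tail (circ_dag C) a)))"

text \<open>
  As the digraph is finite and acyclic, the gate equations have exactly one solution
  \<^term>\<open>val\<close> on the vertices of the circuit.
\<close>

definition computes :: "'v circuit \<Rightarrow> 'v qpoly \<Rightarrow> bool" where
  "computes C p \<longleftrightarrow>
     (\<exists>val. (\<forall>v\<in>verts (circ_dag C). val v = gate_value C val v) \<and> val (circ_root C) = p)"

definition min_monotone_size :: "'v set \<Rightarrow> 'v qpoly \<Rightarrow> nat" where
  "min_monotone_size X p =
     (LEAST s. \<exists>C. circuit X C \<and> monotone_circuit C \<and> computes C p \<and> circuit_size C = s)"

end

theory Submission
  imports Defs "HOL-Library.Transitive_Closure_Table"
begin

text \<open>
  Upper bound: evaluate the sum over all maps bag by bag along a tree decomposition, folding the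
  table of a leaf bag into the table of its neighbour; a table indexed by the maps from a bag to
  \<open>[n]\<close> has at most \<open>n\<^bsup>tw + 1\<^esup>\<close> entries.

  Lower bound: split \<open>[n]\<close> into \<open>k\<close> colour classes of size \<open>N\<close> and consider the \<open>N\<^sup>k\<close> monomials of
  colour-preserving maps. Tracing such a monomial through a monotone circuit splits the edge set
  of \<open>H\<close> again and again, and so yields a tree decomposition of \<open>H\<close>: where \<open>A\<^sub>1 \<union> A\<^sub>2\<close> is split at a
  product, the bag consists of the vertices that \<open>A\<^sub>1\<close> or \<open>A\<^sub>2\<close> share with the rest of \<open>H\<close>. Some
  bag has at least \<open>tw + 1\<close> vertices. If two maps use the same product in the same way, then
  they agree on its bag, since otherwise exchanging the factors would produce a monomial that
  touches more than \<open>k\<close> vertices. So every product serves at most \<open>N\<^bsup>k - tw - 1\<^esup>\<close> of the monomials.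
\<close>

section \<open>Tree decompositions and running intersections\<close>

text \<open>Monotonicity matters because non-negative coefficients never cancel: a context that
  completes one monomial of an intermediate result to a monomial of the output does so for all its
  other monomials as well. This is what permits the exchange. The colouring makes the traced maps
  injective. Their monomials are then multilinear, so every factorisation of such a monomial is a
  partition of edges, and an image vertex tells of which vertex it is the image. A bag is a union of
  two boundaries because the exchange works for each of the two factors separately and fixes the map
  on each boundary. Since fan-in is unbounded and size counts arcs, a binary product is attached to
  an arc rather than to a gate. An arc together with the two edge sets of its factors identifies a
  bag, which costs the factor \<open>4 ^ card E\<close>. When the treewidth is 1, the large bag may
  instead be a single edge read at an input gate, so input gates have to be counted too.\<close>

abbreviation adj :: "'a set set \<Rightarrow> ('a \<times> 'a) set" where
  "adj E \<equiv> {(a, b). {a, b} \<in> E}"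

lemma adj_rtrancl_mono: "E \<subseteq> E' \<Longrightarrow> (u, v) \<in> (adj E)\<^sup>* \<Longrightarrow> (u, v) \<in> (adj E')\<^sup>*"
  by (rule subsetD[OF rtrancl_mono]) auto

lemma adj_rtrancl_sym: "(u, v) \<in> (adj E)\<^sup>* \<Longrightarrow> (v, u) \<in> (adj E)\<^sup>*"
proof -
  have "sym (adj E)" by (auto simp: sym_def insert_commute)
  then show "(u, v) \<in> (adj E)\<^sup>* \<Longrightarrow> (v, u) \<in> (adj E)\<^sup>*"
    by (meson sym_rtrancl symD)
qed

lemma is_tree_singleton: "is_tree {b} {}"
  unfolding is_tree_def simple_graph_def connected_graph_def is_cycle_def
  by (auto intro!: exI[of _ 0])

text \<open>A cycle through \<open>b\<close> would contain two distinct neighbours of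
  \<open>b\<close>, but \<open>{b, c}\<close> is the only edge at \<open>b\<close>.\<close>

lemma is_tree_add_leaf:
  assumes T: "is_tree T F" and c: "c \<in> T" and b: "b \<notin> T"
  shows "is_tree (insert b T) (insert {b, c} F)"
proof -
  have sg: "e \<subseteq> T" "card e = 2" if "e \<in> F" for e
    using T that by (auto simp: is_tree_def simple_graph_def)
  have bc: "b \<noteq> c" using b c by auto
  let ?F = "insert {b, c} F"
  have to_c: "(u, c) \<in> (adj ?F)\<^sup>*" if "u \<in> insert b T" for u
  proof (cases "u = b")
    case True
    then show ?thesis by (intro r_into_rtrancl) auto
  next
    case False
    then have "(u, c) \<in> (adj F)\<^sup>*"
      using T c that by (auto simp: is_tree_def connected_graph_def)
    then show ?thesis by (rule adj_rtrancl_mono[rotated]) auto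
  qed
  have conn: "connected_graph (insert b T) ?F"
    unfolding connected_graph_def
    using to_c by (blast intro: rtrancl_trans adj_rtrancl_sym)
  have "\<not> is_cycle ?F vs" for vs
  proof
    assume cyc: "is_cycle ?F vs"
    define n where "n = length vs"
    have n: "3 \<le> n" and dist: "distinct vs"
      and ed: "\<And>i. i < n \<Longrightarrow> {vs ! i, vs ! (Suc i mod n)} \<in> ?F"
      using cyc by (auto simp: is_cycle_def n_def)
    show False
    proof (cases "b \<in> set vs")
      case False
      have "{vs ! i, vs ! (Suc i mod n)} \<in> F" if "i < n" for i
      proof -
        have "vs ! i \<in> set vs" "vs ! (Suc i mod n) \<in> set vs"
          using that n by (auto simp: n_def intro!: nth_mem mod_less_divisor)
        then have "vs ! i \<noteq> b" "vs ! (Suc i mod n) \<noteq> b" using False by metis+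
        then have "{vs ! i, vs ! (Suc i mod n)} \<noteq> {b, c}" by (auto simp: doubleton_eq_iff)
        then show ?thesis using ed[OF that] by auto
      qed
      then have "is_cycle F vs" using n dist by (auto simp: is_cycle_def n_def)
      then show False using T by (auto simp: is_tree_def)
    next
      case True
      then obtain i where i: "i < n" "vs ! i = b" by (auto simp: in_set_conv_nth n_def)
      \<comment> \<open>\<open>p\<close> and \<open>q\<close> are the cyclic neighbours of position
        \<open>i\<close>; they differ because a cycle has at least three vertices.\<close>
      define p where "p = (if i = 0 then n - 1 else i - 1)"
      have p: "p < n" "Suc p mod n = i" using i n by (auto simp: p_def)
      define q where "q = Suc i mod n"
      have q: "q < n" using n by (auto simp: q_def)
      have "p \<noteq> q" using i n by (auto simp: p_def q_def mod_Suc)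
      then have ne: "vs ! p \<noteq> vs ! q" using dist p q by (simp add: nth_eq_iff_index_eq n_def)
      have "{vs ! p, b} \<in> ?F" using ed[OF p(1)] p(2) i(2) by simp
      then have 1: "{vs ! p, b} = {b, c}" using b sg(1) by auto
      have "{b, vs ! q} \<in> ?F" using ed[OF i(1)] i(2) q_def by simp
      then have 2: "{b, vs ! q} = {b, c}" using b sg(1) by auto
      from 1 2 ne show False by (metis doubleton_eq_iff)
    qed
  qed
  moreover have "simple_graph (insert b T) ?F"
    using sg c bc by (fastforce simp: simple_graph_def)
  ultimately show ?thesis using conn by (auto simp: is_tree_def)
qed

text \<open>A path from \<open>b\<close> to \<open>c\<close> that avoids the edge can be taken
  simple, and the edge closes it to a cycle. It has at least two steps, since a single step would be
  the removed edge.\<close>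

lemma acyclic_edge_is_bridge:
  assumes acyc: "\<nexists>vs. is_cycle F vs" and e: "{b, c} \<in> F" and "b \<noteq> c"
  shows "(b, c) \<notin> (adj (F - {{b, c}}))\<^sup>*"
proof
  let ?r = "\<lambda>x y. {x, y} \<in> F - {{b, c}}"
  assume "(b, c) \<in> (adj (F - {{b, c}}))\<^sup>*"
  then have "?r\<^sup>*\<^sup>* b c" by (simp add: rtranclp_rtrancl_eq)
  then obtain ys where "rtrancl_path ?r b ys c" by (auto simp: rtranclp_eq_rtrancl_path)
  then obtain xs where xs: "rtrancl_path ?r b xs c" "distinct (b # xs)"
    by (rule rtrancl_path_distinct)
  have ne: "xs \<noteq> []" using xs(1) \<open>b \<noteq> c\<close> by (auto elim: rtrancl_path.cases)
  have last: "last xs = c" using xs(1) ne by (rule rtrancl_path_last)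
  have step: "{(b # xs) ! i, xs ! i} \<in> F - {{b, c}}" if "i < length xs" for i
    using rtrancl_path_nth[OF xs(1) that] .
  have "length xs \<noteq> 1"
  proof
    assume "length xs = 1"
    then obtain x where "xs = [x]" by (auto simp: length_Suc_conv)
    then show False using last step[of 0] by auto
  qed
  then have len: "2 \<le> length xs" using ne by (cases xs) (auto simp: Suc_le_eq)
  have "is_cycle F (b # xs)"
    unfolding is_cycle_def
  proof (intro conjI allI impI)
    fix i assume i: "i < length (b # xs)"
    show "{(b # xs) ! i, (b # xs) ! (Suc i mod length (b # xs))} \<in> F"
    proof (cases "i = length xs")
      case True
      then have "(b # xs) ! i = c" using last ne by (simp add: last_conv_nth nth_Cons')
      then show ?thesis using True e by (simp add: insert_commute)
    next
      case False
      then show ?thesis using i step[of i] by auto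
    qed
  qed (use len xs in auto)
  then show False using acyc by blast
qed

text \<open>
  The running intersection property. It holds exactly when the bags are the nodes of a tree
  decomposition, and is the form in which both bounds use treewidth.
\<close>

inductive rip :: "'a set set \<Rightarrow> bool" where
  rip_single: "rip {b}"
| rip_insert: "rip B \<Longrightarrow> c \<in> B \<Longrightarrow> b \<inter> \<Union>B \<subseteq> c \<Longrightarrow> rip (insert b B)"

lemma rip_finite: "rip B \<Longrightarrow> finite B"
  by (induction rule: rip.induct) auto

text \<open>Each new bag \<open>b\<close> is hung as a leaf on \<open>c\<close>. A vertex of
  \<open>b\<close> that occurred before lies in \<open>c\<close>, so its subtree gains the leaf
  \<open>b\<close>; a new vertex gets the one-node subtree \<open>{b}\<close>.\<close>

lemma rip_imp_tree:
  assumes "rip B"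
  shows "\<exists>F. is_tree B F \<and> (\<forall>i\<in>\<Union>B. is_tree {b \<in> B. i \<in> b} (induced_edges F {b \<in> B. i \<in> b}))"
  using assms
proof (induction rule: rip.induct)
  case (rip_single b)
  have "is_tree {b'. b' = b \<and> i \<in> b'} {}" if "i \<in> b" for i
  proof -
    have "{b'. b' = b \<and> i \<in> b'} = {b}" using that by auto
    then show ?thesis by (simp add: is_tree_singleton)
  qed
  then show ?case
    by (intro exI[of _ "{}"]) (auto simp: is_tree_singleton induced_edges_def)
next
  case (rip_insert B c b)
  then obtain F where F: "is_tree B F"
    "\<And>i. i \<in> \<Union>B \<Longrightarrow> is_tree {b \<in> B. i \<in> b} (induced_edges F {b \<in> B. i \<in> b})"
    by blast
  show ?case
  proof (cases "b \<in> B")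
    case True
    then show ?thesis using rip_insert.IH by (simp add: insert_absorb)
  next
    case False
    have sg: "e \<subseteq> B" "card e = 2" if "e \<in> F" for e
      using F(1) that by (auto simp: is_tree_def simple_graph_def)
    have bc: "b \<noteq> c" using False rip_insert by auto
    let ?F = "insert {b, c} F"
    let ?S = "\<lambda>i. {x \<in> B. i \<in> x}" and ?S' = "\<lambda>i. {x \<in> insert b B. i \<in> x}"
    have "is_tree (?S' i) (induced_edges ?F (?S' i))" if i: "i \<in> \<Union>(insert b B)" for i
    proof (cases "i \<in> b")
      case ib: True
      show ?thesis
      proof (cases "i \<in> \<Union>B")
        case True
        then have ic: "i \<in> c" using ib rip_insert by auto
        have "?S' i = insert b (?S i)" using ib by auto
        moreover have "induced_edges ?F (?S' i) = insert {b, c} (induced_edges F (?S i))"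
          using ib ic rip_insert(2) sg(1) False by (fastforce simp: induced_edges_def)
        moreover have "is_tree (insert b (?S i)) (insert {b, c} (induced_edges F (?S i)))"
          by (rule is_tree_add_leaf[OF F(2)[OF True]]) (use False ic rip_insert(2) in auto)
        ultimately show ?thesis by simp
      next
        case iB: False
        then have S': "?S' i = {b}" using ib by auto
        have "induced_edges ?F {b} = {}"
        proof -
          have False if e: "e \<in> F" "e \<subseteq> {b}" for e
          proof -
            have "e = {}" using sg(1)[OF e(1)] e(2) False by auto
            then show False using sg(2)[OF e(1)] by simp
          qed
          then show ?thesis using bc by (auto simp: induced_edges_def)
        qed
        then show ?thesis using S' by (simp add: is_tree_singleton)
      qed
    next
      case nb: False
      then have "?S' i = ?S i" by auto
      moreover have "induced_edges ?F (?S i) = induced_edges F (?S i)"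
        using nb by (auto simp: induced_edges_def)
      ultimately show ?thesis using F(2) i nb by auto
    qed
    then show ?thesis
      using is_tree_add_leaf[OF F(1) rip_insert(2) False] by blast
  qed
qed

lemma rip_imp_tree_decomposition:
  assumes "rip B" "\<Union>B = V" "\<And>e. e \<in> E \<Longrightarrow> \<exists>b\<in>B. e \<subseteq> b"
  shows "\<exists>F. tree_decomposition V E B F"
  using rip_imp_tree[OF assms(1)] assms(2,3) unfolding tree_decomposition_def by blast

lemma rtrancl_leaves_set:
  assumes "(p, q) \<in> R\<^sup>*" "p \<in> P" "q \<notin> P"
  shows "\<exists>x y. (x, y) \<in> R \<and> (p, x) \<in> R\<^sup>* \<and> x \<in> P \<and> y \<notin> P"
  using assms by (induction rule: rtrancl_induct) blast+

text \<open>Any tree edge \<open>{b, c}\<close> leaving \<open>P\<close> will do, as it is a bridge.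
  A vertex \<open>i\<close> of \<open>b\<close> and of some bag in \<open>P\<close>, but not of
  \<open>c\<close>, would give a detour around it: from \<open>b\<close> through the subtree of
  \<open>i\<close> into \<open>P\<close>, then inside \<open>P\<close> to \<open>c\<close>.\<close>

lemma tree_decomposition_extend:
  assumes td: "tree_decomposition V E B F"
    and P: "P \<subseteq> B" "P \<noteq> {}" "P \<noteq> B"
    and conn: "\<And>u v. u \<in> P \<Longrightarrow> v \<in> P \<Longrightarrow> (u, v) \<in> (adj (induced_edges F P))\<^sup>*"
  shows "\<exists>b\<in>B - P. \<exists>c\<in>P. {b, c} \<in> F \<and> b \<inter> \<Union>P \<subseteq> c"
proof -
  have tree: "is_tree B F"
    and sub: "\<And>b. b \<in> B \<Longrightarrow> b \<subseteq> V"
    and subtree: "\<And>i. i \<in> V \<Longrightarrow> is_tree {b \<in> B. i \<in> b} (induced_edges F {b \<in> B. i \<in> b})"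
    using td by (auto simp: tree_decomposition_def)
  obtain p q where pq: "p \<in> P" "q \<in> B" "q \<notin> P" using P by blast
  then have "(p, q) \<in> (adj F)\<^sup>*"
    using tree P by (auto simp: is_tree_def connected_graph_def)
  from rtrancl_leaves_set[OF this pq(1,3)]
  obtain c b where cb: "{c, b} \<in> F" "c \<in> P" "b \<notin> P" by auto
  then have bB: "b \<in> B" using tree by (auto simp: is_tree_def simple_graph_def)
  have bc: "{b, c} \<in> F" "b \<noteq> c" using cb by (auto simp: insert_commute)
  have "i \<in> c" if i: "i \<in> b" "b' \<in> P" "i \<in> b'" for i b'
  proof (rule ccontr)
    assume nc: "i \<notin> c"
    let ?G = "F - {{b, c}}"
    have "i \<in> V" using i sub P by blast
    then have "(b, b') \<in> (adj (induced_edges F {b \<in> B. i \<in> b}))\<^sup>*"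
      using subtree[of i] i bB P by (auto simp: is_tree_def connected_graph_def)
    then have "(b, b') \<in> (adj ?G)\<^sup>*"
      by (rule adj_rtrancl_mono[rotated]) (use nc in \<open>auto simp: induced_edges_def\<close>)
    moreover have "(b', c) \<in> (adj ?G)\<^sup>*"
      by (rule adj_rtrancl_mono[OF _ conn[OF i(2) cb(2)]])
        (use cb in \<open>auto simp: induced_edges_def\<close>)
    ultimately have "(b, c) \<in> (adj ?G)\<^sup>*" by (rule rtrancl_trans)
    then show False
      using acyclic_edge_is_bridge[OF _ bc] tree by (auto simp: is_tree_def)
  qed
  then have "b \<inter> \<Union>P \<subseteq> c" by auto
  then show ?thesis using bB cb bc by blast
qed

text \<open>Bags are added one at a time to a part \<open>P\<close> of the tree. That
  \<open>P\<close> is connected within itself is carried along, because the next extension relies on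
  it.\<close>

lemma tree_decomposition_imp_rip:
  assumes td: "tree_decomposition V E B F" and "finite V"
  shows "rip B"
proof -
  have tree: "is_tree B F" and "B \<subseteq> Pow V" using td by (auto simp: tree_decomposition_def)
  then have fin: "finite B" using \<open>finite V\<close> by (meson finite_Pow_iff finite_subset)
  obtain b0 where b0: "b0 \<in> B" using tree by (auto simp: is_tree_def connected_graph_def)
  have "\<exists>P\<subseteq>B. card P = Suc m \<and> rip P \<and> (\<forall>u\<in>P. \<forall>v\<in>P. (u, v) \<in> (adj (induced_edges F P))\<^sup>*)"
    if "Suc m \<le> card B" for m
    using that
  proof (induction m)
    case 0
    show ?case
      by (intro exI[of _ "{b0}"]) (use b0 in \<open>auto intro: rip_single\<close>)
  next
    case (Suc m)
    then obtain P where P: "P \<subseteq> B" "card P = Suc m" "rip P"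
      and conn: "\<And>u v. u \<in> P \<Longrightarrow> v \<in> P \<Longrightarrow> (u, v) \<in> (adj (induced_edges F P))\<^sup>*"
      by auto
    have "P \<noteq> {}" "P \<noteq> B" using P Suc.prems by auto
    from tree_decomposition_extend[OF td P(1) this conn]
    obtain b c where bc: "b \<in> B - P" "c \<in> P" "{b, c} \<in> F" "b \<inter> \<Union>P \<subseteq> c" by blast
    let ?G = "induced_edges F (insert b P)"
    have to_c: "(u, c) \<in> (adj ?G)\<^sup>*" if "u \<in> insert b P" for u
    proof (cases "u = b")
      case True
      then show ?thesis using bc by (intro r_into_rtrancl) (auto simp: induced_edges_def)
    next
      case False
      then have "(u, c) \<in> (adj (induced_edges F P))\<^sup>*" using conn bc that by auto
      then show ?thesis
        by (rule adj_rtrancl_mono[rotated]) (auto simp: induced_edges_def)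
    qed
    have "\<forall>u\<in>insert b P. \<forall>v\<in>insert b P. (u, v) \<in> (adj ?G)\<^sup>*"
      using to_c by (blast intro: rtrancl_trans adj_rtrancl_sym)
    moreover have "card (insert b P) = Suc (Suc m)"
      using P bc fin by (simp add: card_insert_disjoint finite_subset)
    moreover have "rip (insert b P)" using P bc by (blast intro: rip_insert)
    ultimately show ?case using P bc by (intro exI[of _ "insert b P"]) auto
  qed
  from this[of "card B - 1"] obtain P where "P \<subseteq> B" "card P = card B" "rip P"
    using fin b0 by (metis One_nat_def Suc_pred card_gt_0_iff empty_iff order_refl)
  then show ?thesis using fin card_subset_eq by metis
qed

section \<open>Upper bound\<close>

definition leaf_gates :: "'v set \<Rightarrow> 'v gate set" where
  "leaf_gates X = Var ` X \<union> Const ` {0..}"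

text \<open>A gate value over an arbitrary index set in place of the incoming arcs, so that operands
  can be indexed by edges, maps or booleans and renamed to fresh arcs afterwards.\<close>

definition op_value :: "'v gate \<Rightarrow> ('i \<Rightarrow> 'v qpoly) \<Rightarrow> 'i set \<Rightarrow> 'v qpoly" where
  "op_value g f I = (case g of Var x \<Rightarrow> poly_var x | Const c \<Rightarrow> poly_const c
     | Plus \<Rightarrow> sum f I | Times \<Rightarrow> prod f I)"

lemma gate_value_conv_op_value:
  "gate_value C val v =
     op_value (circ_gate C v) (\<lambda>a. val (tail (circ_dag C) a)) (in_arcs (circ_dag C) v)"
  by (simp add: gate_value_def op_value_def split: gate.split)

lemma op_value_cong:
  "I = J \<Longrightarrow> (\<And>i. i \<in> J \<Longrightarrow> f i = f' i) \<Longrightarrow> op_value g f I = op_value g f' J"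
  by (auto simp: op_value_def split: gate.split intro: sum.cong prod.cong)

lemma op_value_reindex:
  "inj_on h I \<Longrightarrow> op_value g f (h ` I) = op_value g (\<lambda>i. f (h i)) I"
  by (simp add: op_value_def sum.reindex prod.reindex o_def split: gate.split)

text \<open>
  A circuit without a distinguished root in which every polynomial of \<open>F\<close> is computed. Numbering
  the vertices topologically makes acyclicity immediate when a gate is added.
\<close>

definition computable :: "'v set \<Rightarrow> nat \<Rightarrow> 'v qpoly set \<Rightarrow> bool" where
  "computable X s F \<longleftrightarrow> (\<exists>C val. fin_digraph (circ_dag C) \<and>
     (\<forall>a\<in>arcs (circ_dag C). tail (circ_dag C) a < head (circ_dag C) a) \<and>
     card (arcs (circ_dag C)) \<le> s \<and>
     (\<forall>v\<in>verts (circ_dag C). circ_gate C v \<in>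
        (if in_arcs (circ_dag C) v = {} then leaf_gates X else {Plus, Times})) \<and>
     (\<forall>v\<in>verts (circ_dag C). val v = gate_value C val v) \<and>
     F \<subseteq> val ` verts (circ_dag C))"

lemma computable_mono: "computable X s F \<Longrightarrow> s \<le> t \<Longrightarrow> computable X t F"
  unfolding computable_def
  by (elim ex_forward conj_forward) auto

lemma computable_empty: "computable X 0 {}"
  unfolding computable_def
  by (intro exI[of _ "\<lparr>circ_dag = \<lparr>verts = {}, arcs = {}, tail = id, head = id\<rparr>,
        circ_root = 0, circ_gate = \<lambda>_. Plus\<rparr>"])
    (auto intro!: fin_digraph.intro wf_digraph.intro simp: fin_digraph_axioms_def)

text \<open>The new gate is numbered above all present vertices, so that its arcs increase, and
  receives one fresh arc per index; repeated operands may become parallel arcs.\<close>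

lemma computable_gate:
  assumes "computable X s F" "finite I" "f ` I \<subseteq> F"
    and gate: "g \<in> (if I = {} then leaf_gates X else {Plus, Times})"
  shows "computable X (s + card I) (insert (op_value g f I) F)"
proof -
  obtain C val where C: "fin_digraph (circ_dag C)"
      "\<And>a. a \<in> arcs (circ_dag C) \<Longrightarrow> tail (circ_dag C) a < head (circ_dag C) a"
      "card (arcs (circ_dag C)) \<le> s"
      "\<And>v. v \<in> verts (circ_dag C) \<Longrightarrow> circ_gate C v \<in>
        (if in_arcs (circ_dag C) v = {} then leaf_gates X else {Plus, Times})"
      "\<And>v. v \<in> verts (circ_dag C) \<Longrightarrow> val v = gate_value C val v"
      "F \<subseteq> val ` verts (circ_dag C)"
    using assms(1) unfolding computable_def by blast
  define G where "G = circ_dag C"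
  interpret fin_digraph G using C(1) by (simp add: G_def)
  obtain v where v: "\<And>u. u \<in> verts G \<Longrightarrow> u < v"
    using finite_verts finite_nat_set_iff_bounded by auto
  obtain N where N: "\<And>a. a \<in> arcs G \<Longrightarrow> a < N"
    using finite_arcs finite_nat_set_iff_bounded by auto
  obtain h0 where "bij_betw h0 I {0..<card I}"
    using ex_bij_betw_finite_nat[OF assms(2)] by blast
  then have h0: "inj_on h0 I" by (simp add: bij_betw_def)
  define h where "h = (\<lambda>i. N + h0 i)"
  have h: "inj_on h I" "\<And>i. h i \<notin> arcs G"
    using h0 N by (auto simp: h_def inj_on_def dest: N)
  have "\<forall>i\<in>I. \<exists>u. u \<in> verts G \<and> val u = f i"
    using assms(3) C(6) by (fastforce simp: G_def)
  then obtain u where u: "\<And>i. i \<in> I \<Longrightarrow> u i \<in> verts G" "\<And>i. i \<in> I \<Longrightarrow> val (u i) = f i"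
    by metis
  define G' where "G' = \<lparr>verts = insert v (verts G), arcs = arcs G \<union> h ` I,
    tail = \<lambda>a. if a \<in> arcs G then tail G a else u (inv_into I h a),
    head = \<lambda>a. if a \<in> arcs G then head G a else v\<rparr>"
  define C' where "C' = \<lparr>circ_dag = G', circ_root = v, circ_gate = (circ_gate C)(v := g)\<rparr>"
  define val' where "val' = val(v := op_value g f I)"
  have v_new: "v \<notin> verts G" using v by blast
  have tail_h: "tail G' (h i) = u i" if "i \<in> I" for i
    using h that by (simp add: G'_def)
  have in_v: "in_arcs G' v = h ` I"
    using h v_new head_in_verts by (auto simp: in_arcs_def G'_def)
  have in_old: "in_arcs G' w = in_arcs G w" if "w \<in> verts G" for w
    using that h v_new by (auto simp: in_arcs_def G'_def)
  have tail_old: "tail G' a = tail G a" "tail G a \<noteq> v" if "a \<in> in_arcs G w" for a w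
    using that v_new tail_in_verts[of a] by (auto simp: in_arcs_def G'_def)
  have "fin_digraph G'"
    by unfold_locales (use h u assms(2) in \<open>auto simp: G'_def\<close>)
  moreover have "tail G' a < head G' a" if "a \<in> arcs G'" for a
    using that C(2) h u v by (auto simp: G'_def G_def)
  moreover have "card (arcs G') \<le> s + card I"
    using C(3) h(1) card_Un_le[of "arcs G" "h ` I"]
    by (simp add: G'_def card_image G_def[symmetric])
  moreover have "circ_gate C' w \<in> (if in_arcs G' w = {} then leaf_gates X else {Plus, Times})"
    if "w \<in> verts G'" for w
  proof (cases "w = v")
    case True
    then show ?thesis using gate by (simp add: in_v C'_def)
  next
    case False
    then have "w \<in> verts G" using that by (simp add: G'_def)
    then show ?thesis using C(4)[of w] False by (simp add: in_old C'_def G_def)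
  qed
  moreover have "val' w = gate_value C' val' w" if "w \<in> verts G'" for w
  proof (cases "w = v")
    case True
    have "op_value g (\<lambda>a. val' (tail G' a)) (h ` I) = op_value g (\<lambda>i. val' (tail G' (h i))) I"
      by (rule op_value_reindex[OF h(1)])
    also have "\<dots> = op_value g f I"
      by (rule op_value_cong) (use u v_new in \<open>auto simp: tail_h val'_def\<close>)
    finally show ?thesis
      using True by (simp add: gate_value_conv_op_value C'_def in_v val'_def)
  next
    case False
    then have w: "w \<in> verts G" using that by (simp add: G'_def)
    have "val w = gate_value C val w" using C(5) w by (simp add: G_def)
    also have "\<dots> = gate_value C' val' w"
    proof -
      have "op_value (circ_gate C w) (\<lambda>a. val (tail G a)) (in_arcs G w) =
          op_value (circ_gate C w) (\<lambda>a. val' (tail G' a)) (in_arcs G' w)"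
        by (rule op_value_cong) (use in_old[OF w] tail_old in \<open>simp_all add: val'_def\<close>)
      then show ?thesis
        unfolding gate_value_conv_op_value using False by (simp add: C'_def G_def[symmetric])
    qed
    finally show ?thesis using False by (simp add: val'_def)
  qed
  moreover have "insert (op_value g f I) F \<subseteq> val' ` verts G'"
  proof -
    have "val' ` verts G' = insert (op_value g f I) (val ` verts G)"
      using v_new by (auto simp: val'_def G'_def image_iff)
    then show ?thesis using C(6) by (auto simp: G_def)
  qed
  ultimately show ?thesis
    unfolding computable_def by (intro exI[of _ C'] exI[of _ val']) (simp add: C'_def)
qed

lemma computable_leaf:
  assumes "computable X s F" "g \<in> leaf_gates X"
  shows "computable X s (insert (op_value g f {}) F)"
  using computable_gate[OF assms(1), of "{}"] assms(2) by simp

lemma computable_sum: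
  assumes "computable X s F" "finite I" "f ` I \<subseteq> F"
  shows "computable X (s + card I) (insert (sum f I) F)"
proof (cases "I = {}")
  case True
  \<comment> \<open>A gate without incoming arcs must be a leaf, so the empty sum becomes a
    constant.\<close>
  have "Const 0 \<in> leaf_gates X" by (auto simp: leaf_gates_def)
  from computable_leaf[OF assms(1) this, of undefined] True show ?thesis
    by (simp add: op_value_def poly_const_def)
next
  case False
  with computable_gate[OF assms, of Plus] show ?thesis by (simp add: op_value_def)
qed

lemma computable_prod:
  assumes "computable X s F" "finite I" "f ` I \<subseteq> F"
  shows "computable X (s + card I) (insert (prod f I) F)"
proof (cases "I = {}")
  case True
  have "Const 1 \<in> leaf_gates X" by (auto simp: leaf_gates_def)
  from computable_leaf[OF assms(1) this, of undefined] True show ?thesis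
    by (simp add: op_value_def poly_const_def)
next
  case False
  with computable_gate[OF assms, of Times] show ?thesis by (simp add: op_value_def)
qed

lemma computable_leaves:
  assumes "finite L" "L \<subseteq> poly_var ` X \<union> poly_const ` {0..}"
  shows "computable X 0 L"
  using assms
proof (induction L rule: finite_induct)
  case (insert p L)
  then have "computable X 0 L" by auto
  moreover obtain g where "g \<in> leaf_gates X" "p = op_value g undefined {}"
  proof -
    have "p \<in> poly_var ` X \<or> p \<in> poly_const ` {0..}" using insert by auto
    then show ?thesis
    proof
      assume "p \<in> poly_var ` X"
      then obtain x where "x \<in> X" "p = poly_var x" by auto
      then show ?thesis by (intro that[of "Var x"]) (auto simp: leaf_gates_def op_value_def)
    next
      assume "p \<in> poly_const ` {0..}"
      then obtain c where "c \<ge> 0" "p = poly_const c" by auto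
      then show ?thesis by (intro that[of "Const c"]) (auto simp: leaf_gates_def op_value_def)
    qed
  qed
  ultimately show ?case using computable_leaf by metis
qed (simp add: computable_empty)

lemma computable_sums:
  assumes "finite J" "computable X s F"
    and "\<And>j. j \<in> J \<Longrightarrow> finite (I j) \<and> card (I j) \<le> c \<and> f j ` I j \<subseteq> F"
  shows "computable X (s + card J * c) (F \<union> (\<lambda>j. sum (f j) (I j)) ` J)"
  using assms
proof (induction J rule: finite_induct)
  case (insert j J)
  then have "computable X (s + card J * c) (F \<union> (\<lambda>j. sum (f j) (I j)) ` J)" by auto
  from computable_sum[OF this, of "I j" "f j"]
  have "computable X (s + card J * c + card (I j))
      (insert (sum (f j) (I j)) (F \<union> (\<lambda>j. sum (f j) (I j)) ` J))"
    using insert.prems by blast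
  then have "computable X (s + card (insert j J) * c)
      (insert (sum (f j) (I j)) (F \<union> (\<lambda>j. sum (f j) (I j)) ` J))"
    by (rule computable_mono) (use insert in auto)
  then show ?case by simp
qed simp

lemma computable_prods:
  assumes "finite J" "computable X s F"
    and "\<And>j. j \<in> J \<Longrightarrow> finite (I j) \<and> card (I j) \<le> c \<and> f j ` I j \<subseteq> F"
  shows "computable X (s + card J * c) (F \<union> (\<lambda>j. prod (f j) (I j)) ` J)"
  using assms
proof (induction J rule: finite_induct)
  case (insert j J)
  then have "computable X (s + card J * c) (F \<union> (\<lambda>j. prod (f j) (I j)) ` J)" by auto
  from computable_prod[OF this, of "I j" "f j"]
  have "computable X (s + card J * c + card (I j))
      (insert (prod (f j) (I j)) (F \<union> (\<lambda>j. prod (f j) (I j)) ` J))"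
    using insert.prems by blast
  then have "computable X (s + card (insert j J) * c)
      (insert (prod (f j) (I j)) (F \<union> (\<lambda>j. prod (f j) (I j)) ` J))"
    by (rule computable_mono) (use insert in auto)
  then show ?case by simp
qed simp

text \<open>Every vertex of a circuit must reach the root, so only the vertices that reach a chosen
  vertex of value \<open>p\<close> are kept. This set is closed under predecessors, so the kept
  gates retain all their inputs and their values.\<close>

lemma computable_imp_circuit:
  assumes "computable X s F" "p \<in> F"
  shows "\<exists>C. circuit X C \<and> monotone_circuit C \<and> computes C p \<and> circuit_size C \<le> s"
proof -
  obtain C val where C: "fin_digraph (circ_dag C)"
      "\<And>a. a \<in> arcs (circ_dag C) \<Longrightarrow> tail (circ_dag C) a < head (circ_dag C) a"
      "card (arcs (circ_dag C)) \<le> s"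
      "\<And>v. v \<in> verts (circ_dag C) \<Longrightarrow> circ_gate C v \<in>
        (if in_arcs (circ_dag C) v = {} then leaf_gates X else {Plus, Times})"
      "\<And>v. v \<in> verts (circ_dag C) \<Longrightarrow> val v = gate_value C val v"
      "F \<subseteq> val ` verts (circ_dag C)"
    using assms(1) unfolding computable_def by blast
  define G where "G = circ_dag C"
  interpret G: fin_digraph G using C(1) by (simp add: G_def)
  obtain r where r: "r \<in> verts G" "val r = p" using C(6) assms(2) by (auto simp: G_def)
  define G' where "G' = \<lparr>verts = {v. v \<rightarrow>\<^sup>*\<^bsub>G\<^esub> r}, arcs = {a \<in> arcs G. head G a \<rightarrow>\<^sup>*\<^bsub>G\<^esub> r},
    tail = tail G, head = head G\<rparr>"
  define C' where "C' = \<lparr>circ_dag = G', circ_root = r, circ_gate = circ_gate C\<rparr>"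
  have sub: "verts G' \<subseteq> verts G" "arcs G' \<subseteq> arcs G"
    by (auto simp: G'_def elim: reachable_in_vertsE)
  have fin: "fin_digraph G'"
  proof
    show "finite (verts G')" "finite (arcs G')"
      using sub G.finite_verts G.finite_arcs finite_subset by blast+
    fix a assume "a \<in> arcs G'"
    then have a: "a \<in> arcs G" "head G a \<rightarrow>\<^sup>*\<^bsub>G\<^esub> r" by (auto simp: G'_def)
    then have "tail G a \<rightarrow>\<^bsub>G\<^esub> head G a" by (auto simp: arcs_ends_conv)
    with a show "tail G' a \<in> verts G'" "head G' a \<in> verts G'"
      by (auto simp: G'_def intro: G.adj_reachable_trans)
  qed
  interpret G': fin_digraph G' by (rule fin)
  have in_eq: "in_arcs G' v = in_arcs G v" if "v \<in> verts G'" for v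
    using that by (auto simp: in_arcs_def G'_def)
  have "acyclic (arcs_ends G')"
  proof (rule acyclic_subset[of less_than])
    show "acyclic less_than" by (simp add: wf_acyclic)
    show "arcs_ends G' \<subseteq> less_than"
      using C(2) sub by (auto simp: arcs_ends_conv G'_def G_def)
  qed
  moreover have "v \<rightarrow>\<^sup>*\<^bsub>G'\<^esub> r" if "v \<in> verts G'" for v
  proof -
    have "v \<rightarrow>\<^sup>*\<^bsub>G\<^esub> r" using that by (simp add: G'_def)
    then show ?thesis
    proof (induction rule: G.converse_reachable_induct)
      case base
      have "r \<in> verts G'" using r by (simp add: G'_def)
      then show ?case by (rule G'.reachable_refl)
    next
      case (step x y)
      then have "x \<rightarrow>\<^bsub>G'\<^esub> y" by (auto simp: arcs_ends_conv G'_def)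
      then show ?case using step by (auto intro: G'.adj_reachable_trans)
    qed
  qed
  moreover have "if in_arcs G' v = {} then circ_gate C v \<in> Var ` X \<union> range Const
      else circ_gate C v \<in> {Plus, Times}" if "v \<in> verts G'" for v
  proof -
    have "v \<in> verts (circ_dag C)" using that sub by (auto simp: G_def)
    from C(4)[OF this] show ?thesis
      unfolding in_eq[OF that] by (auto simp: leaf_gates_def G_def[symmetric] split: if_splits)
  qed
  moreover have "r \<in> verts G'" using r by (simp add: G'_def)
  ultimately have "circuit X C'"
    unfolding circuit_def C'_def circuit.simps using fin by blast
  moreover have "monotone_circuit C'"
    unfolding monotone_circuit_def
  proof (intro ballI allI impI)
    fix v c assume v: "v \<in> verts (circ_dag C')" "circ_gate C' v = Const c"
    then show "0 \<le> c"
      using C(4)[of v] sub by (auto simp: C'_def G_def leaf_gates_def split: if_splits)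
  qed
  moreover have "computes C' p"
    unfolding computes_def
  proof (intro exI[of _ val] conjI ballI)
    fix v assume "v \<in> verts (circ_dag C')"
    then have v: "v \<in> verts G'" by (simp add: C'_def)
    then have "val v = gate_value C val v" using C(5) sub by (auto simp: G_def)
    also have "\<dots> = gate_value C' val v"
      unfolding gate_value_conv_op_value
      using in_eq[OF v] by (simp add: C'_def G_def[symmetric]) (simp add: G'_def)
    finally show "val v = gate_value C' val v" .
  qed (simp add: C'_def r)
  moreover have "circuit_size C' \<le> s"
    using C(3) card_mono[OF G.finite_arcs sub(2)] by (simp add: circuit_size_def C'_def G_def)
  ultimately show ?thesis by blast
qed

section \<open>Summation over maps along a tree decomposition\<close>

text \<open>A map on the enlarged union is a pair of a map on the old union and a map on
  \<open>b\<close> that agree on \<open>U\<close>; distributivity moves the sum over the second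
  component inwards.\<close>

lemma sum_join_extensional:
  fixes f :: "'a set \<Rightarrow> ('a \<Rightarrow> 'b) \<Rightarrow> 'c :: comm_semiring_1"
  assumes "finite B" "b \<notin> B" "finite b" "finite (\<Union>B)" "finite D"
  defines "U \<equiv> b \<inter> \<Union>B"
  shows "(\<Sum>\<phi>\<in>\<Union>(insert b B) \<rightarrow>\<^sub>E D. \<Prod>b'\<in>insert b B. f b' (restrict \<phi> b')) =
    (\<Sum>\<phi>\<in>\<Union>B \<rightarrow>\<^sub>E D. (\<Prod>b'\<in>B. f b' (restrict \<phi> b')) *
       (\<Sum>\<psi> | \<psi> \<in> b \<rightarrow>\<^sub>E D \<and> restrict \<psi> U = restrict \<phi> U. f b \<psi>))"
proof -
  let ?R = "\<lambda>\<phi>. {\<psi>. \<psi> \<in> b \<rightarrow>\<^sub>E D \<and> restrict \<psi> U = restrict \<phi> U}"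
  have finR: "finite (?R \<phi>)" for \<phi>
    by (rule finite_subset[of _ "b \<rightarrow>\<^sub>E D"]) (use assms in \<open>auto intro: finite_PiE\<close>)
  have restr: "restrict (restrict \<phi> (\<Union>B)) b' = restrict \<phi> b'" if "b' \<in> B" for \<phi> :: "'a \<Rightarrow> 'b" and b'
    using that by (auto simp: restrict_def fun_eq_iff)
  have agree: "\<phi> x = \<psi> x" if "\<psi> \<in> ?R \<phi>" "x \<in> b" "x \<in> \<Union>B" for \<phi> \<psi> x
  proof -
    have "restrict \<psi> U x = restrict \<phi> U x" using that by simp
    then show ?thesis using that by (simp add: U_def)
  qed
  have "(\<Sum>\<phi>\<in>\<Union>B \<rightarrow>\<^sub>E D. (\<Prod>b'\<in>B. f b' (restrict \<phi> b')) * sum (f b) (?R \<phi>)) =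
    (\<Sum>(\<phi>, \<psi>)\<in>Sigma (\<Union>B \<rightarrow>\<^sub>E D) ?R. (\<Prod>b'\<in>B. f b' (restrict \<phi> b')) * f b \<psi>)"
    unfolding sum_distrib_left
    by (rule sum.Sigma) (use assms finR in \<open>auto intro: finite_PiE\<close>)
  also have "\<dots> = (\<Sum>\<phi>\<in>\<Union>(insert b B) \<rightarrow>\<^sub>E D. \<Prod>b'\<in>insert b B. f b' (restrict \<phi> b'))"
  proof (rule sum.reindex_bij_witness[where
        j = "\<lambda>(\<phi>, \<psi>) x. if x \<in> \<Union>B then \<phi> x else \<psi> x" and
        i = "\<lambda>\<phi>. (restrict \<phi> (\<Union>B), restrict \<phi> b)"])
    fix p assume p: "p \<in> Sigma (\<Union>B \<rightarrow>\<^sub>E D) ?R"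
    obtain \<phi> \<psi> where [simp]: "p = (\<phi>, \<psi>)" by (cases p)
    have \<phi>: "\<phi> \<in> \<Union>B \<rightarrow>\<^sub>E D" and \<psi>: "\<psi> \<in> b \<rightarrow>\<^sub>E D" and R: "\<psi> \<in> ?R \<phi>" using p by auto
    define \<chi> where "\<chi> = (\<lambda>x. if x \<in> \<Union>B then \<phi> x else \<psi> x)"
    have 1: "restrict \<chi> (\<Union>B) = \<phi>"
      using PiE_arb[OF \<phi>] by (fastforce simp: \<chi>_def restrict_def fun_eq_iff)
    have 2: "restrict \<chi> b = \<psi>"
      using PiE_arb[OF \<psi>] agree[OF R] by (fastforce simp: \<chi>_def restrict_def fun_eq_iff)
    have j: "(case p of (\<phi>, \<psi>) \<Rightarrow> \<lambda>x. if x \<in> \<Union>B then \<phi> x else \<psi> x) = \<chi>"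
      by (simp add: \<chi>_def)
    show "(restrict (case p of (\<phi>, \<psi>) \<Rightarrow> \<lambda>x. if x \<in> \<Union>B then \<phi> x else \<psi> x) (\<Union>B),
           restrict (case p of (\<phi>, \<psi>) \<Rightarrow> \<lambda>x. if x \<in> \<Union>B then \<phi> x else \<psi> x) b) = p"
      unfolding j by (simp add: 1 2)
    show "(case p of (\<phi>, \<psi>) \<Rightarrow> \<lambda>x. if x \<in> \<Union>B then \<phi> x else \<psi> x) \<in> \<Union>(insert b B) \<rightarrow>\<^sub>E D"
      unfolding j
    proof (rule PiE_I)
      fix x assume "x \<in> \<Union>(insert b B)"
      then show "\<chi> x \<in> D" using PiE_mem[OF \<phi>] PiE_mem[OF \<psi>] by (auto simp: \<chi>_def)
    next
      fix x assume "x \<notin> \<Union>(insert b B)"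
      then show "\<chi> x = undefined" using PiE_arb[OF \<psi>] by (auto simp: \<chi>_def)
    qed
    have "restrict \<chi> b' = restrict \<phi> b'" if "b' \<in> B" for b'
      using restr[OF that, of \<chi>] by (simp add: 1)
    then show "(\<Prod>b'\<in>insert b B.
        f b' (restrict (case p of (\<phi>, \<psi>) \<Rightarrow> \<lambda>x. if x \<in> \<Union>B then \<phi> x else \<psi> x) b')) =
      (case p of (\<phi>, \<psi>) \<Rightarrow> (\<Prod>b'\<in>B. f b' (restrict \<phi> b')) * f b \<psi>)"
      unfolding j using assms(1,2) 2 by (simp add: mult.commute)
  next
    fix \<phi> assume \<phi>: "\<phi> \<in> \<Union>(insert b B) \<rightarrow>\<^sub>E D"
    show "(case (restrict \<phi> (\<Union>B), restrict \<phi> b) of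
        (\<phi>, \<psi>) \<Rightarrow> \<lambda>x. if x \<in> \<Union>B then \<phi> x else \<psi> x) = \<phi>"
      using PiE_arb[OF \<phi>] by (auto simp: fun_eq_iff restrict_def)
    show "(restrict \<phi> (\<Union>B), restrict \<phi> b) \<in> Sigma (\<Union>B \<rightarrow>\<^sub>E D) ?R"
      using \<phi> by (auto simp: U_def fun_eq_iff restrict_def PiE_iff extensional_def)
  qed
  finally show ?thesis by simp
qed

text \<open>Such maps are determined by their restrictions to \<open>V - U\<close>. The estimate
  bounds the fan-in of the sums in the upper bound and the number of maps per witness in the lower
  bound.\<close>

lemma card_PiE_agree_le:
  assumes "finite V" "\<And>i. i \<in> V \<Longrightarrow> finite (C i)" "K \<subseteq> PiE V C"
    and agree: "\<And>a b i. a \<in> K \<Longrightarrow> b \<in> K \<Longrightarrow> i \<in> U \<Longrightarrow> a i = b i"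
  shows "card K \<le> (\<Prod>i\<in>V - U. card (C i))"
proof -
  have "inj_on (\<lambda>a. restrict a (V - U)) K"
  proof (rule inj_onI)
    fix a b assume ab: "a \<in> K" "b \<in> K" and eq: "restrict a (V - U) = restrict b (V - U)"
    show "a = b"
    proof (rule PiE_ext)
      show "a \<in> PiE V C" "b \<in> PiE V C" using ab assms(3) by auto
      fix i assume "i \<in> V"
      then show "a i = b i" using fun_cong[OF eq, of i] agree[OF ab] by (cases "i \<in> U") auto
    qed
  qed
  moreover have "(\<lambda>a. restrict a (V - U)) ` K \<subseteq> PiE (V - U) C"
    using assms(3) by (auto simp: PiE_iff subset_iff)
  moreover have "finite (PiE (V - U) C)" using assms by (auto intro: finite_PiE)
  ultimately have "card K \<le> card (PiE (V - U) C)" by (rule card_inj_on_le)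
  then show ?thesis using assms by (simp add: card_PiE)
qed

text \<open>The bag inserted last is a leaf and is summed out first. The tables \<open>f\<close> are
  arbitrary because the recursion continues with the tables changed by this elimination. The 3 pays
  for the sums over the table of the leaf (once \<open>card D ^ m\<close>) and the binary products
  that update the table of \<open>c\<close> (twice).\<close>

lemma computable_bag_sum:
  assumes "rip B" "\<And>b. b \<in> B \<Longrightarrow> finite b \<and> card b \<le> m"
    and D: "finite D" "D \<noteq> {}"
    and "computable X s F" "\<And>b \<psi>. b \<in> B \<Longrightarrow> \<psi> \<in> b \<rightarrow>\<^sub>E D \<Longrightarrow> f b \<psi> \<in> F"
  shows "\<exists>F'. computable X (s + 3 * card B * card D ^ m) F' \<and>
    (\<Sum>\<phi>\<in>\<Union>B \<rightarrow>\<^sub>E D. \<Prod>b\<in>B. f b (restrict \<phi> b)) \<in> F'"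
  using assms(1,2,5,6)
proof (induction arbitrary: f s F rule: rip.induct)
  case (rip_single b)
  have pow: "card D ^ card b \<le> card D ^ m"
    using rip_single D by (intro power_increasing) (auto simp: Suc_le_eq card_gt_0_iff)
  have "computable X (s + card (b \<rightarrow>\<^sub>E D)) (insert (sum (f b) (b \<rightarrow>\<^sub>E D)) F)"
    by (rule computable_sum) (use rip_single D in \<open>auto intro: finite_PiE\<close>)
  then have "computable X (s + 3 * card {b} * card D ^ m) (insert (sum (f b) (b \<rightarrow>\<^sub>E D)) F)"
    by (rule computable_mono) (use rip_single D pow in \<open>auto simp: card_PiE\<close>)
  moreover have "(\<Sum>\<phi>\<in>\<Union>{b} \<rightarrow>\<^sub>E D. \<Prod>b\<in>{b}. f b (restrict \<phi> b)) = sum (f b) (b \<rightarrow>\<^sub>E D)"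
    by (auto intro!: sum.cong simp: PiE_restrict)
  ultimately show ?case by (metis insertI1)
next
  case (rip_insert B c b)
  have finB: "finite B" using rip_insert.hyps(1) by (rule rip_finite)
  show ?case
  proof (cases "b \<in> B")
    case True
    then show ?thesis using rip_insert.IH[of s F f] rip_insert.prems by (simp add: insert_absorb)
  next
    case False
    define U where "U = b \<inter> \<Union>B"
    have U: "U \<subseteq> b" "U \<subseteq> c" using rip_insert by (auto simp: U_def)
    have b: "finite b" "card b \<le> m" and c: "finite c" "card c \<le> m"
      using rip_insert by auto
    have finU: "finite U" using U b finite_subset by blast
    have pow: "card D ^ i \<le> card D ^ m" if "i \<le> m" for i
      using that D by (intro power_increasing) (auto simp: Suc_le_eq card_gt_0_iff)
    let ?R = "\<lambda>\<chi>. {\<psi>. \<psi> \<in> b \<rightarrow>\<^sub>E D \<and> restrict \<psi> U = \<chi>}"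
    \<comment> \<open>One sum per map on the separator \<open>U\<close>. There are
      \<open>card D ^ card U\<close> of them, each with at most \<open>card D ^ card (b - U)\<close>
      summands, so together they cost at most \<open>card D ^ card b\<close> arcs.\<close>
    define g where "g = (\<lambda>\<chi>. sum (f b) (?R \<chi>))"
    define F1 where "F1 = F \<union> g ` (U \<rightarrow>\<^sub>E D)"
    have "computable X (s + card (U \<rightarrow>\<^sub>E D) * card D ^ card (b - U)) F1"
      unfolding F1_def g_def
    proof (rule computable_sums)
      show "finite (U \<rightarrow>\<^sub>E D)" using finU D by (auto intro: finite_PiE)
      show "computable X s F" by fact
      fix \<chi>
      have "finite (?R \<chi>)"
        by (rule finite_subset[of _ "b \<rightarrow>\<^sub>E D"]) (use b D in \<open>auto intro: finite_PiE\<close>)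
      moreover have "card (?R \<chi>) \<le> card D ^ card (b - U)"
      proof -
        have "\<psi> i = \<psi>' i" if "\<psi> \<in> ?R \<chi>" "\<psi>' \<in> ?R \<chi>" "i \<in> U" for \<psi> \<psi>' i
          using that by (metis (mono_tags, lifting) mem_Collect_eq restrict_apply')
        then have "card (?R \<chi>) \<le> (\<Prod>i\<in>b - U. card D)"
          using b D by (intro card_PiE_agree_le) auto
        then show ?thesis by simp
      qed
      ultimately show "finite (?R \<chi>) \<and> card (?R \<chi>) \<le> card D ^ card (b - U) \<and> f b ` ?R \<chi> \<subseteq> F"
        using rip_insert.prems(3) by auto
    qed
    moreover have "card (U \<rightarrow>\<^sub>E D) * card D ^ card (b - U) = card D ^ card b"
    proof -
      have "card U + card (b - U) = card b"
        using b U finU by (metis card_mono card_Diff_subset le_add_diff_inverse)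
      then show ?thesis using finU by (simp add: card_PiE flip: power_add)
    qed
    ultimately have F1: "computable X (s + card D ^ m) F1"
      using pow[OF b(2)] by (auto elim: computable_mono)
    \<comment> \<open>The sums \<open>g\<close> are absorbed into the table of \<open>c\<close>
      alone, which is possible because \<open>U\<close> is contained in \<open>c\<close>.\<close>
    define f' where "f' = (\<lambda>b' \<psi>. if b' = c then f c \<psi> * g (restrict \<psi> U) else f b' \<psi>)"
    \<comment> \<open>The two factors are indexed by booleans to fit the format of a product over an
      index set.\<close>
    define k where "k = (\<lambda>\<psi> t. if t then f c \<psi> else g (restrict \<psi> U))"
    define F2 where "F2 = F1 \<union> (\<lambda>\<psi>. prod (k \<psi>) UNIV) ` (c \<rightarrow>\<^sub>E D)"
    have "computable X (s + card D ^ m + card (c \<rightarrow>\<^sub>E D) * 2) F2"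
      unfolding F2_def
    proof (rule computable_prods)
      show "finite (c \<rightarrow>\<^sub>E D)" using c D by (auto intro: finite_PiE)
      fix \<psi> assume \<psi>: "\<psi> \<in> c \<rightarrow>\<^sub>E D"
      then have "f c \<psi> \<in> F1" using rip_insert by (auto simp: F1_def)
      moreover have "restrict \<psi> U \<in> U \<rightarrow>\<^sub>E D" using \<psi> U by auto
      then have "g (restrict \<psi> U) \<in> F1" by (auto simp: F1_def)
      ultimately show "finite (UNIV :: bool set) \<and> card (UNIV :: bool set) \<le> 2 \<and> range (k \<psi>) \<subseteq> F1"
        by (auto simp: k_def)
    qed (rule F1)
    then have F2: "computable X (s + 3 * card D ^ m) F2"
      by (rule computable_mono) (use c pow[OF c(2)] in \<open>simp add: card_PiE\<close>)
    have "\<exists>F'. computable X (s + 3 * card D ^ m + 3 * card B * card D ^ m) F' \<and>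
        (\<Sum>\<phi>\<in>\<Union>B \<rightarrow>\<^sub>E D. \<Prod>b\<in>B. f' b (restrict \<phi> b)) \<in> F'"
    proof (rule rip_insert.IH[OF _ F2])
      fix b' \<psi> assume b': "b' \<in> B" "\<psi> \<in> b' \<rightarrow>\<^sub>E D"
      show "f' b' \<psi> \<in> F2"
      proof (cases "b' = c")
        case True
        then have "f' b' \<psi> = prod (k \<psi>) UNIV" by (simp add: f'_def k_def UNIV_bool mult.commute)
        then show ?thesis using True b' by (auto simp: F2_def)
      next
        case False
        then show ?thesis using b' rip_insert.prems(3) by (auto simp: F2_def F1_def f'_def)
      qed
    qed (use rip_insert.prems in auto)
    moreover have "(\<Sum>\<phi>\<in>\<Union>B \<rightarrow>\<^sub>E D. \<Prod>b\<in>B. f' b (restrict \<phi> b)) =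
        (\<Sum>\<phi>\<in>\<Union>(insert b B) \<rightarrow>\<^sub>E D. \<Prod>b'\<in>insert b B. f b' (restrict \<phi> b'))"
    proof -
      have "(\<Prod>b\<in>B. f' b (restrict \<phi> b)) = (\<Prod>b\<in>B. f b (restrict \<phi> b)) * g (restrict \<phi> U)" for \<phi>
      proof -
        have "f' b' (restrict \<phi> b') = f b' (restrict \<phi> b') *
            (if b' = c then g (restrict \<phi> U) else 1)" for b'
          using U by (auto simp: f'_def Int_absorb1)
        then show ?thesis
          using finB rip_insert.hyps(2) by (simp add: prod.distrib prod.delta)
      qed
      then show ?thesis
        unfolding g_def U_def
        by (subst sum_join_extensional) (use finB False b rip_insert.prems D in auto)
    qed
    moreover have "s + 3 * card D ^ m + 3 * card B * card D ^ m =
        s + 3 * card (insert b B) * card D ^ m"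
      using False finB by (simp add: algebra_simps)
    ultimately show ?thesis by (simp only:)
  qed
qed

text \<open>Per bag and map, at most \<open>card E\<close> arcs build the initial table entry and 3
  pay for the summation.\<close>

lemma hom_poly_upper_bound:
  assumes V: "finite V" and E: "simple_graph V E"
    and td: "tree_decomposition V E B F" and m: "\<And>b. b \<in> B \<Longrightarrow> card b \<le> m" and n: "n \<ge> 1"
  shows "\<exists>C. circuit (complete_edges {1..n}) C \<and> monotone_circuit C \<and>
    computes C (hom_poly V E n) \<and> circuit_size C \<le> card B * (card E + 3) * n ^ m"
proof -
  define D where "D = {1..n}"
  have D: "finite D" "D \<noteq> {}" "card D = n" using n by (auto simp: D_def)
  define X where "X = complete_edges D"
  have rip: "rip B" using tree_decomposition_imp_rip[OF td V] .
  have BV: "\<And>b. b \<in> B \<Longrightarrow> b \<subseteq> V" using td by (auto simp: tree_decomposition_def)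
  have finb: "finite b" if "b \<in> B" for b using BV[OF that] V finite_subset by blast
  have finB: "finite B" using rip by (rule rip_finite)
  have "\<exists>b\<in>B. i \<in> b" if "i \<in> V" for i
    using td that by (auto simp: tree_decomposition_def is_tree_def connected_graph_def)
  then have UB: "\<Union>B = V" using BV by blast
  have Esub: "e \<subseteq> V" "card e = 2" if "e \<in> E" for e using E that by (auto simp: simple_graph_def)
  have finE: "finite E" using Esub(1) V by (meson Pow_iff finite_Pow_iff finite_subset subsetI)
  have "\<forall>e\<in>E. \<exists>b\<in>B. e \<subseteq> b" using td by (auto simp: tree_decomposition_def)
  \<comment> \<open>Each edge is charged to a single bag that contains it, so that its variable
    enters the product only once.\<close>
  then obtain \<beta> where \<beta>: "\<And>e. e \<in> E \<Longrightarrow> \<beta> e \<in> B" "\<And>e. e \<in> E \<Longrightarrow> e \<subseteq> \<beta> e" by metis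
  \<comment> \<open>Images that are not edges of the complete graph get the value 0, so that the sum
    may run over all maps instead of the homomorphisms.\<close>
  define y where "y = (\<lambda>e. if e \<in> X then poly_var e else poly_const 0)"
  define f where "f = (\<lambda>b \<psi>. \<Prod>e\<in>{e \<in> E. \<beta> e = b}. y (\<psi> ` e))"
  have F0: "computable X 0 (y ` Pow D)"
    by (rule computable_leaves) (use D in \<open>auto simp: y_def\<close>)
  define J where "J = Sigma B (\<lambda>b. b \<rightarrow>\<^sub>E D)"
  have pow: "card (b \<rightarrow>\<^sub>E D) \<le> n ^ m" if "b \<in> B" for b
    using that D m n finb by (auto simp: card_PiE intro!: power_increasing)
  have finJ: "finite J" unfolding J_def using finB finb D by (auto intro!: finite_PiE)
  have "card J = (\<Sum>b\<in>B. card (b \<rightarrow>\<^sub>E D))"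
    unfolding J_def using finB finb D by (intro card_SigmaI) (auto intro!: finite_PiE)
  also have "\<dots> \<le> card B * n ^ m" using sum_bounded_above[OF pow, of B] by simp
  finally have cardJ: "card J \<le> card B * n ^ m" .
  define F1 where "F1 = y ` Pow D \<union>
    (\<lambda>j. prod (\<lambda>e. y (snd j ` e)) {e \<in> E. \<beta> e = fst j}) ` J"
  have "computable X (0 + card J * card E) F1"
    unfolding F1_def
  proof (rule computable_prods[OF finJ F0])
    fix j assume j: "j \<in> J"
    have "snd j ` e \<subseteq> D" if "e \<in> E" "\<beta> e = fst j" for e
      using j \<beta>(2)[OF that(1)] that(2) by (auto simp: J_def PiE_iff)
    moreover have "card {e \<in> E. \<beta> e = fst j} \<le> card E" using finE by (intro card_mono) auto
    ultimately show "finite {e \<in> E. \<beta> e = fst j} \<and> card {e \<in> E. \<beta> e = fst j} \<le> card E \<and>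
        (\<lambda>e. y (snd j ` e)) ` {e \<in> E. \<beta> e = fst j} \<subseteq> y ` Pow D"
      using finE by auto
  qed
  then have F1: "computable X (card B * n ^ m * card E) F1"
    by (rule computable_mono) (use cardJ in simp)
  have f_mem: "f b \<psi> \<in> F1" if "b \<in> B" "\<psi> \<in> b \<rightarrow>\<^sub>E D" for b \<psi>
    using that by (auto simp: F1_def J_def f_def intro!: rev_image_eqI[of "(b, \<psi>)"])
  obtain F2 where F2: "computable X (card B * n ^ m * card E + 3 * card B * card D ^ m) F2"
    "(\<Sum>\<phi>\<in>\<Union>B \<rightarrow>\<^sub>E D. \<Prod>b\<in>B. f b (restrict \<phi> b)) \<in> F2"
    using computable_bag_sum[OF rip _ D(1,2) F1, of m f] f_mem finb m by blast
  have "(\<Prod>b\<in>B. f b (restrict \<phi> b)) = (\<Prod>e\<in>E. y (\<phi> ` e))" for \<phi>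
  proof -
    have "(\<Prod>b\<in>B. f b (restrict \<phi> b)) = (\<Prod>b\<in>B. \<Prod>e\<in>{e \<in> E. \<beta> e = b}. y (\<phi> ` e))"
      unfolding f_def
    proof (intro prod.cong refl)
      fix b e assume "e \<in> {e \<in> E. \<beta> e = b}"
      then have "e \<subseteq> b" using \<beta>(2) by auto
      then have "restrict \<phi> b ` e = \<phi> ` e" by (intro image_cong) auto
      then show "y (restrict \<phi> b ` e) = y (\<phi> ` e)" by simp
    qed
    also have "\<dots> = (\<Prod>e\<in>E. y (\<phi> ` e))"
      by (rule prod.group) (use finE finB \<beta> in auto)
    finally show ?thesis .
  qed
  then have "(\<Sum>\<phi>\<in>\<Union>B \<rightarrow>\<^sub>E D. \<Prod>b\<in>B. f b (restrict \<phi> b)) = (\<Sum>\<phi>\<in>V \<rightarrow>\<^sub>E D. \<Prod>e\<in>E. y (\<phi> ` e))"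
    by (simp add: UB)
  also have "\<dots> = (\<Sum>\<phi>\<in>graph_homs V E D X. \<Prod>e\<in>E. y (\<phi> ` e))"
  proof (rule sum.mono_neutral_right)
    show "finite (V \<rightarrow>\<^sub>E D)" using V D by (auto intro: finite_PiE)
    show "graph_homs V E D X \<subseteq> V \<rightarrow>\<^sub>E D" by (auto simp: graph_homs_def)
    show "\<forall>\<phi>\<in>(V \<rightarrow>\<^sub>E D) - graph_homs V E D X. (\<Prod>e\<in>E. y (\<phi> ` e)) = 0"
    proof
      fix \<phi> assume "\<phi> \<in> (V \<rightarrow>\<^sub>E D) - graph_homs V E D X"
      then obtain i j where ij: "{i, j} \<in> E" "{\<phi> i, \<phi> j} \<notin> X" by (auto simp: graph_homs_def)
      then have "y (\<phi> ` {i, j}) = 0" by (simp add: y_def poly_const_def)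
      then show "(\<Prod>e\<in>E. y (\<phi> ` e)) = 0" using finE ij(1) by (intro prod_zero bexI[of _ "{i, j}"])
    qed
  qed
  also have "\<dots> = hom_poly V E n"
    unfolding hom_poly_def D_def[symmetric] X_def[symmetric]
  proof (intro sum.cong prod.cong refl)
    fix \<phi> e assume \<phi>: "\<phi> \<in> graph_homs V E D X" and e: "e \<in> E"
    obtain i j where "e = {i, j}" using Esub(2)[OF e] by (auto simp: card_2_iff)
    then have "\<phi> ` e \<in> X" using \<phi> e by (auto simp: graph_homs_def)
    then show "y (\<phi> ` e) = poly_var (\<phi> ` e)" by (simp add: y_def)
  qed
  finally have "hom_poly V E n \<in> F2" using F2(2) by simp
  from computable_imp_circuit[OF F2(1) this]
  show ?thesis by (simp add: X_def D_def algebra_simps)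
qed

section \<open>Monomials of monotone computations\<close>

abbreviation (input) lookup where "lookup \<equiv> Poly_Mapping.lookup"
abbreviation (input) keys where "keys \<equiv> Poly_Mapping.keys"

definition nonneg_poly :: "'v qpoly \<Rightarrow> bool" where
  "nonneg_poly p \<longleftrightarrow> (\<forall>m. 0 \<le> lookup p m)"

lemma sum_monomials: "(\<Sum>m\<in>keys p. Poly_Mapping.single m (lookup p m)) = p"
proof (rule poly_mapping_eqI)
  fix m
  have "(\<Sum>k\<in>keys p. lookup p k when k = m) = lookup p m"
    by (cases "m \<in> keys p") (auto simp: when_def in_keys_iff)
  then show "lookup (\<Sum>m\<in>keys p. Poly_Mapping.single m (lookup p m)) m = lookup p m"
    by (simp add: lookup_sum lookup_single)
qed

lemma lookup_mult:
  fixes p q :: "'v qpoly"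
  shows "lookup (p * q) m = (\<Sum>k\<in>keys p. \<Sum>l\<in>keys q. lookup p k * lookup q l when k + l = m)"
proof -
  have "p * q = (\<Sum>k\<in>keys p. Poly_Mapping.single k (lookup p k)) *
      (\<Sum>l\<in>keys q. Poly_Mapping.single l (lookup q l))"
    by (simp only: sum_monomials)
  also have "\<dots> = (\<Sum>k\<in>keys p. \<Sum>l\<in>keys q. Poly_Mapping.single (k + l) (lookup p k * lookup q l))"
    by (simp add: sum_product mult_single)
  finally show ?thesis by (simp add: lookup_sum lookup_single)
qed

lemma nonneg_poly_mult: "nonneg_poly p \<Longrightarrow> nonneg_poly q \<Longrightarrow> nonneg_poly (p * q)"
  by (auto simp: nonneg_poly_def lookup_mult when_def intro!: sum_nonneg)

lemma nonneg_poly_single: "0 \<le> c \<Longrightarrow> nonneg_poly (Poly_Mapping.single m c)"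
  by (auto simp: nonneg_poly_def lookup_single when_def)

lemma nonneg_poly_sum: "(\<And>i. i \<in> I \<Longrightarrow> nonneg_poly (f i)) \<Longrightarrow> nonneg_poly (sum f I)"
  by (auto simp: nonneg_poly_def lookup_sum intro!: sum_nonneg)

lemma nonneg_poly_one: "nonneg_poly 1"
  using nonneg_poly_single[of 1 0] by simp

lemma nonneg_poly_prod: "(\<And>i. i \<in> I \<Longrightarrow> nonneg_poly (f i)) \<Longrightarrow> nonneg_poly (prod f I)"
  by (induction I rule: infinite_finite_induct) (auto intro: nonneg_poly_mult nonneg_poly_one)

text \<open>The term of \<open>k\<close> and \<open>l\<close> is positive and no term is negative.
  Monotonicity enters the lower bound through this fact and its analogue for sums.\<close>

lemma keys_mult_nonneg:
  assumes "nonneg_poly p" "nonneg_poly q" "k \<in> keys p" "l \<in> keys q"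
  shows "k + l \<in> keys (p * q)"
proof -
  let ?t = "\<lambda>i j. lookup p i * lookup q j when i + j = k + l"
  have nn: "0 \<le> ?t i j" for i j using assms by (auto simp: nonneg_poly_def when_def)
  have "0 < lookup p k" "0 < lookup q l"
    using assms by (auto simp: nonneg_poly_def in_keys_iff order_less_le)
  then have "0 < ?t k l" by simp
  also have "\<dots> \<le> (\<Sum>j\<in>keys q. ?t k j)"
    by (rule member_le_sum) (use nn assms in auto)
  also have "\<dots> \<le> (\<Sum>i\<in>keys p. \<Sum>j\<in>keys q. ?t i j)"
    by (rule member_le_sum) (use nn assms in \<open>auto intro!: sum_nonneg\<close>)
  finally show ?thesis by (simp add: in_keys_iff lookup_mult)
qed

lemma keys_sum_nonneg:
  assumes "finite I" "\<And>i. i \<in> I \<Longrightarrow> nonneg_poly (f i)" "i \<in> I" "m \<in> keys (f i)"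
  shows "m \<in> keys (sum f I)"
proof -
  have "0 < lookup (f i) m"
    using assms by (auto simp: nonneg_poly_def in_keys_iff order_less_le)
  also have "\<dots> \<le> (\<Sum>i\<in>I. lookup (f i) m)"
    by (rule member_le_sum) (use assms in \<open>auto simp: nonneg_poly_def\<close>)
  finally show ?thesis by (simp add: in_keys_iff lookup_sum)
qed

section \<open>Monomials of maps and their factorisations\<close>

definition edge_monomial :: "('a \<Rightarrow> 'b) \<Rightarrow> 'a set set \<Rightarrow> 'b set \<Rightarrow>\<^sub>0 nat" where
  "edge_monomial \<phi> A = (\<Sum>e\<in>A. Poly_Mapping.single (\<phi> ` e) 1)"

lemma lookup_edge_monomial:
  assumes "finite A" shows "lookup (edge_monomial \<phi> A) x = card {e \<in> A. \<phi> ` e = x}"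
  using assms
  by (simp add: edge_monomial_def lookup_sum lookup_single when_def sum.If_cases Int_def)

lemma keys_edge_monomial: "finite A \<Longrightarrow> keys (edge_monomial \<phi> A) = (\<lambda>e. \<phi> ` e) ` A"
  by (auto simp: in_keys_iff lookup_edge_monomial)

lemma edge_monomial_union:
  "finite A \<Longrightarrow> finite B \<Longrightarrow> A \<inter> B = {} \<Longrightarrow>
     edge_monomial \<phi> (A \<union> B) = edge_monomial \<phi> A + edge_monomial \<phi> B"
  by (simp add: edge_monomial_def sum.union_disjoint)

lemma prod_poly_var_edges:
  "finite E \<Longrightarrow> (\<Prod>e\<in>E. poly_var (\<phi> ` e)) = Poly_Mapping.single (edge_monomial \<phi> E) 1"
  by (induction E rule: finite_induct) (auto simp: edge_monomial_def poly_var_def mult_single)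

lemma lookup_edge_monomial_inj:
  assumes "finite A" "inj_on (\<lambda>e. \<phi> ` e) A" "e \<in> A"
  shows "lookup (edge_monomial \<phi> A) (\<phi> ` e) = 1"
proof -
  have "{e' \<in> A. \<phi> ` e' = \<phi> ` e} = {e}" using assms by (auto dest: inj_onD)
  then show ?thesis using assms(1) by (simp add: lookup_edge_monomial)
qed

lemma edge_monomial_eqI:
  assumes fin: "finite A" and inj: "inj_on (\<lambda>e. \<phi> ` e) A"
    and on: "\<And>e. e \<in> A \<Longrightarrow> lookup m (\<phi> ` e) = 1"
    and off: "\<And>x. x \<notin> (\<lambda>e. \<phi> ` e) ` A \<Longrightarrow> lookup m x = 0"
  shows "m = edge_monomial \<phi> A"
proof (rule poly_mapping_eqI)
  fix x
  show "lookup m x = lookup (edge_monomial \<phi> A) x"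
  proof (cases "x \<in> (\<lambda>e. \<phi> ` e) ` A")
    case True
    then show ?thesis using on lookup_edge_monomial_inj[OF fin inj] by auto
  next
    case False
    then have "x \<notin> keys (edge_monomial \<phi> A)" by (simp add: keys_edge_monomial[OF fin])
    then show ?thesis using off[OF False] by (simp add: in_keys_iff)
  qed
qed

text \<open>Injectivity on edges keeps all exponents at most 1, so each variable, and with it its
  unique edge, goes to exactly one of the two factors.\<close>

lemma edge_monomial_split:
  assumes fin: "finite A" and inj: "inj_on (\<lambda>e. \<phi> ` e) A" and eq: "edge_monomial \<phi> A = m1 + m2"
  obtains A1 A2 where "A1 \<union> A2 = A" "A1 \<inter> A2 = {}"
    "m1 = edge_monomial \<phi> A1" "m2 = edge_monomial \<phi> A2"
proof -
  have lk: "lookup (edge_monomial \<phi> A) x = lookup m1 x + lookup m2 x" for x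
    by (simp add: eq lookup_add)
  have on: "lookup m1 (\<phi> ` e) + lookup m2 (\<phi> ` e) = 1" if "e \<in> A" for e
    using lookup_edge_monomial_inj[OF fin inj that] lk by simp
  have off: "lookup m1 x = 0 \<and> lookup m2 x = 0" if "x \<notin> (\<lambda>e. \<phi> ` e) ` A" for x
  proof -
    have "x \<notin> keys (edge_monomial \<phi> A)" using that by (simp add: keys_edge_monomial[OF fin])
    then show ?thesis using lk[of x] by (simp add: in_keys_iff)
  qed
  define A1 where "A1 = {e \<in> A. lookup m1 (\<phi> ` e) = 1}"
  define A2 where "A2 = {e \<in> A. lookup m2 (\<phi> ` e) = 1}"
  have "m1 = edge_monomial \<phi> A1"
  proof (rule edge_monomial_eqI)
    fix x assume x: "x \<notin> (\<lambda>e. \<phi> ` e) ` A1"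
    show "lookup m1 x = 0"
    proof (cases "x \<in> (\<lambda>e. \<phi> ` e) ` A")
      case True
      then obtain e where e: "e \<in> A" "x = \<phi> ` e" by auto
      then have "lookup m1 x \<noteq> 1" using x by (auto simp: A1_def)
      then show ?thesis using on[OF e(1)] e(2) by auto
    qed (use off in auto)
  qed (use fin inj in \<open>auto simp: A1_def intro: inj_on_subset\<close>)
  moreover have "m2 = edge_monomial \<phi> A2"
  proof (rule edge_monomial_eqI)
    fix x assume x: "x \<notin> (\<lambda>e. \<phi> ` e) ` A2"
    show "lookup m2 x = 0"
    proof (cases "x \<in> (\<lambda>e. \<phi> ` e) ` A")
      case True
      then obtain e where e: "e \<in> A" "x = \<phi> ` e" by auto
      then have "lookup m2 x \<noteq> 1" using x by (auto simp: A2_def)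
      then show ?thesis using on[OF e(1)] e(2) by auto
    qed (use off in auto)
  qed (use fin inj in \<open>auto simp: A2_def intro: inj_on_subset\<close>)
  moreover have "A1 \<union> A2 = A" using on by (auto simp: A1_def A2_def add_is_1)
  moreover have "A1 \<inter> A2 = {}" using on by (fastforce simp: A1_def A2_def)
  ultimately show ?thesis using that by blast
qed

section \<open>Lower bound\<close>

text \<open>The middle set of the separation \<open>(A, E - A)\<close> in the sense of branch
  decompositions.\<close>

definition boundary :: "'a set set \<Rightarrow> 'a set set \<Rightarrow> 'a set" where
  "boundary E A = \<Union>A \<inter> \<Union>(E - A)"

text \<open>A rooted branch decomposition whose width is measured on the bags of the tree
  decomposition it induces. The boundary of \<open>A1 \<union> A2\<close> lies in the union of the
  two boundaries and needs no term of its own. Empty edge sets occur because a factor such as a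
  constant contributes no edge.\<close>

inductive branch_decomposable :: "nat \<Rightarrow> 'a set set \<Rightarrow> 'a set set \<Rightarrow> bool" for w E where
  empty: "branch_decomposable w E {}"
| single: "e \<in> E \<Longrightarrow> card e \<le> w \<Longrightarrow> branch_decomposable w E {e}"
| union: "branch_decomposable w E A1 \<Longrightarrow> branch_decomposable w E A2 \<Longrightarrow> A1 \<inter> A2 = {} \<Longrightarrow>
    card (boundary E A1 \<union> boundary E A2) \<le> w \<Longrightarrow> branch_decomposable w E (A1 \<union> A2)"

lemma branch_decomposable_subset: "branch_decomposable w E A \<Longrightarrow> A \<subseteq> E"
  by (induction rule: branch_decomposable.induct) auto

text \<open>
  The bags are attached top-down to a given tree, so that trees never have to be re-rooted.
\<close>

lemma branch_decomposable_extend_rip: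
  assumes "branch_decomposable w E A" "rip B" "c \<in> B" "boundary E A \<subseteq> c"
    "\<Union>B \<inter> \<Union>A \<subseteq> boundary E A" "\<forall>b\<in>B. card b \<le> w"
  shows "\<exists>B'. rip B' \<and> B \<subseteq> B' \<and> (\<forall>b\<in>B'. card b \<le> w) \<and> \<Union>B' \<subseteq> \<Union>B \<union> \<Union>A \<and> (\<forall>e\<in>A. \<exists>b\<in>B'. e \<subseteq> b)"
  using assms
proof (induction arbitrary: B c rule: branch_decomposable.induct)
  case empty
  then show ?case by (intro exI[of _ B]) auto
next
  case (single e)
  have "rip (insert e B)" using single by (intro rip_insert[of B c]) auto
  then show ?case using single by (intro exI[of _ "insert e B"]) auto
next
  case (union A1 A2)
  have A: "A1 \<subseteq> E" "A2 \<subseteq> E" using union.hyps(1,2)[THEN branch_decomposable_subset] .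
  \<comment> \<open>The bag of the split. Its vertices lie in
    \<open>\<Union>(A1 \<union> A2)\<close>, which meets the earlier bags only inside
    \<open>c\<close>, so it can be attached to \<open>c\<close>; both halves are then attached to
    \<open>d\<close>.\<close>
  define d where "d = boundary E A1 \<union> boundary E A2"
  have bd: "boundary E (A1 \<union> A2) \<inter> \<Union>A1 \<subseteq> boundary E A1"
      "boundary E (A1 \<union> A2) \<inter> \<Union>A2 \<subseteq> boundary E A2"
      "\<Union>A1 \<inter> \<Union>A2 \<subseteq> boundary E A1" "\<Union>A1 \<inter> \<Union>A2 \<subseteq> boundary E A2"
      "boundary E A1 \<subseteq> \<Union>A1" "boundary E A2 \<subseteq> \<Union>A2"
    using union.hyps(3) A unfolding boundary_def by blast+
  have d: "d \<subseteq> \<Union>(A1 \<union> A2)" using bd(5,6) unfolding d_def by blast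
  have "rip (insert d B)"
    using union.prems(1,2) by (rule rip_insert) (use d union.prems(3,4) in blast)
  moreover have "\<Union>(insert d B) \<inter> \<Union>A1 \<subseteq> boundary E A1"
    using union.prems(4) bd unfolding d_def by blast
  moreover have "\<forall>b\<in>insert d B. card b \<le> w" using union.prems(5) union.hyps(4) by (simp add: d_def)
  ultimately obtain B1 where B1: "rip B1" "insert d B \<subseteq> B1" "\<forall>b\<in>B1. card b \<le> w"
      "\<Union>B1 \<subseteq> \<Union>(insert d B) \<union> \<Union>A1" "\<forall>e\<in>A1. \<exists>b\<in>B1. e \<subseteq> b"
    using union.IH(1)[of "insert d B" d] by (auto simp: d_def)
  have "\<Union>B1 \<inter> \<Union>A2 \<subseteq> boundary E A2"
    using B1(4) union.prems(4) bd unfolding d_def by blast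
  then obtain B2 where B2: "rip B2" "B1 \<subseteq> B2" "\<forall>b\<in>B2. card b \<le> w"
      "\<Union>B2 \<subseteq> \<Union>B1 \<union> \<Union>A2" "\<forall>e\<in>A2. \<exists>b\<in>B2. e \<subseteq> b"
    using union.IH(2)[of B1 d] B1 by (auto simp: d_def)
  have "\<Union>B2 \<subseteq> \<Union>B \<union> \<Union>(A1 \<union> A2)" using B2(4) B1(4) d by auto
  moreover have "\<forall>e\<in>A1 \<union> A2. \<exists>b\<in>B2. e \<subseteq> b" using B1(5) B2(2,5) by blast
  moreover have "B \<subseteq> B2" using B1 B2 by auto
  ultimately show ?case using B2(1,3) by blast
qed

lemma branch_decomposable_treewidth_le:
  assumes "branch_decomposable w E E" "\<Union>E = V"
  shows "treewidth V E \<le> w - 1"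
proof -
  \<comment> \<open>The construction can start from the empty bag, because it only has to contain
    this empty boundary.\<close>
  have "boundary E E = {}" by (simp add: boundary_def)
  then obtain B where B: "rip B" "\<forall>b\<in>B. card b \<le> w" "\<Union>B \<subseteq> \<Union>E" "\<forall>e\<in>E. \<exists>b\<in>B. e \<subseteq> b" "B \<noteq> {}"
    using branch_decomposable_extend_rip[OF assms(1) rip_single[of "{}"], of "{}"] by auto
  have "\<Union>B = V" using B assms(2) by blast
  then obtain F where "tree_decomposition V E B F"
    using rip_imp_tree_decomposition[OF B(1)] B(4) by blast
  then have "treewidth V E \<le> decomposition_width B"
    unfolding treewidth_def by (intro Least_le) blast
  also have "\<dots> \<le> w - 1"
    unfolding decomposition_width_def using B(2,5) rip_finite[OF B(1)]
    by (intro diff_le_mono) simp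
  finally show ?thesis .
qed

text \<open>
  A substitute for parse trees: \<open>p\<close> is an intermediate result, and the edges outside \<open>A\<close> provide a
  context for it, so that exchanging subtrees amounts to exchanging monomials of \<open>p\<close>.
\<close>

definition occurs ::
    "'a set set \<Rightarrow> 'b set qpoly \<Rightarrow> ('a \<Rightarrow> 'b) \<Rightarrow> 'a set set \<Rightarrow> 'b set qpoly \<Rightarrow> bool" where
  "occurs E P a A p \<longleftrightarrow> A \<subseteq> E \<and> edge_monomial a A \<in> keys p \<and>
     (\<forall>m\<in>keys p. edge_monomial a (E - A) + m \<in> keys P)"

text \<open>The summand that supplies the monomial inherits the context, since all its other
  monomials survive in the sum.\<close>

lemma occurs_sum:
  assumes "occurs E P a A (sum f I)" "finite I" "\<And>i. i \<in> I \<Longrightarrow> nonneg_poly (f i)"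
  shows "\<exists>i\<in>I. occurs E P a A (f i)"
proof -
  obtain i where "i \<in> I" "edge_monomial a A \<in> keys (f i)"
    using assms(1) keys_sum[of f I] unfolding occurs_def by blast
  then show ?thesis
    using assms(1) keys_sum_nonneg[of I f i] assms(2,3) unfolding occurs_def by blast
qed

text \<open>The context of one factor is the context of the product enlarged by the monomial that
  the other factor contributes.\<close>

lemma occurs_mult:
  assumes occ: "occurs E P a A (p * q)" and nn: "nonneg_poly p" "nonneg_poly q"
    and E: "finite E" "inj_on (\<lambda>e. a ` e) E"
  obtains A1 A2 where "A1 \<union> A2 = A" "A1 \<inter> A2 = {}" "occurs E P a A1 p" "occurs E P a A2 q"
proof -
  have A: "A \<subseteq> E" "finite A" using occ E by (auto simp: occurs_def intro: finite_subset)
  obtain m1 m2 where m: "edge_monomial a A = m1 + m2" "m1 \<in> keys p" "m2 \<in> keys q"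
    using occ keys_mult[of p q] unfolding occurs_def by blast
  obtain A1 A2 where A12: "A1 \<union> A2 = A" "A1 \<inter> A2 = {}"
      "m1 = edge_monomial a A1" "m2 = edge_monomial a A2"
    using edge_monomial_split[OF A(2) inj_on_subset[OF E(2) A(1)] m(1)] by blast
  have fin: "finite A1" "finite A2" "finite (E - A)" using A A12 E finite_subset by auto
  have ctx: "edge_monomial a (E - A) + m \<in> keys P" if "m \<in> keys (p * q)" for m
    using occ that by (auto simp: occurs_def)
  have 1: "edge_monomial a (E - A1) = edge_monomial a (E - A) + m2"
  proof -
    have "E - A1 = (E - A) \<union> A2" "(E - A) \<inter> A2 = {}" using A12 A by auto
    then show ?thesis using edge_monomial_union[of "E - A" A2 a] fin A12(4) by simp
  qed
  have 2: "edge_monomial a (E - A2) = edge_monomial a (E - A) + m1"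
  proof -
    have "E - A2 = (E - A) \<union> A1" "(E - A) \<inter> A1 = {}" using A12 A by auto
    then show ?thesis using edge_monomial_union[of "E - A" A1 a] fin A12(3) by simp
  qed
  have "occurs E P a A1 p"
    unfolding occurs_def 1
  proof (intro conjI ballI)
    fix m assume "m \<in> keys p"
    from ctx[OF keys_mult_nonneg[OF nn this m(3)]]
    show "edge_monomial a (E - A) + m2 + m \<in> keys P" by (simp add: ac_simps)
  qed (use A A12 m in auto)
  moreover have "occurs E P a A2 q"
    unfolding occurs_def 2
  proof (intro conjI ballI)
    fix m assume "m \<in> keys q"
    from ctx[OF keys_mult_nonneg[OF nn m(2) this]]
    show "edge_monomial a (E - A) + m1 + m \<in> keys P" by (simp add: ac_simps)
  qed (use A A12 m in auto)
  ultimately show ?thesis using that A12 by blast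
qed

lemma keys_hom_poly:
  assumes "finite V" "finite E"
  shows "keys (hom_poly V E n) =
    (\<lambda>\<phi>. edge_monomial \<phi> E) ` graph_homs V E {1..n} (complete_edges {1..n})" (is "_ = _ ` ?H")
proof -
  have "finite (V \<rightarrow>\<^sub>E {1..n})" using assms by (auto intro: finite_PiE)
  then have fin: "finite ?H" by (rule rev_finite_subset) (auto simp: graph_homs_def)
  have eq: "hom_poly V E n = (\<Sum>\<phi>\<in>?H. Poly_Mapping.single (edge_monomial \<phi> E) (1 :: rat))"
    using assms by (simp add: hom_poly_def prod_poly_var_edges)
  show ?thesis
  proof
    show "keys (hom_poly V E n) \<subseteq> (\<lambda>\<phi>. edge_monomial \<phi> E) ` ?H"
      unfolding eq using keys_sum[of "\<lambda>\<phi>. Poly_Mapping.single (edge_monomial \<phi> E) (1 :: rat)" ?H]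
      by fastforce
    show "(\<lambda>\<phi>. edge_monomial \<phi> E) ` ?H \<subseteq> keys (hom_poly V E n)"
      unfolding eq
    proof
      fix m assume "m \<in> (\<lambda>\<phi>. edge_monomial \<phi> E) ` ?H"
      then obtain \<phi> where \<phi>: "\<phi> \<in> ?H" "m = edge_monomial \<phi> E" by blast
      show "m \<in> keys (\<Sum>\<phi>\<in>?H. Poly_Mapping.single (edge_monomial \<phi> E) (1 :: rat))"
        by (rule keys_sum_nonneg[OF fin _ \<phi>(1)]) (simp_all add: \<phi>(2) nonneg_poly_single)
    qed
  qed
qed

text \<open>Every vertex other than the root has an outgoing arc, because it reaches the root. This
  converts a count of input gates into size, which counts arcs.\<close>

lemma card_verts_le:
  assumes "circuit X C"
  shows "card (verts (circ_dag C)) \<le> card (arcs (circ_dag C)) + 1"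
proof -
  define G where "G = circ_dag C"
  interpret fin_digraph G using assms by (simp add: circuit_def G_def)
  have "v \<in> tail G ` arcs G" if v: "v \<in> verts G" "v \<noteq> circ_root C" for v
  proof -
    have "v \<rightarrow>\<^sup>*\<^bsub>G\<^esub> circ_root C" using assms v by (auto simp: circuit_def G_def)
    then show ?thesis
      by (cases rule: converse_reachable_cases) (use v in auto)
  qed
  then have "verts G \<subseteq> insert (circ_root C) (tail G ` arcs G)" by blast
  then have "card (verts G) \<le> card (insert (circ_root C) (tail G ` arcs G))"
    by (intro card_mono) auto
  also have "\<dots> \<le> Suc (card (tail G ` arcs G))" by (rule card_insert_le_m1) auto
  also have "\<dots> \<le> Suc (card (arcs G))" by (simp add: card_image_le)
  finally show ?thesis by (simp add: G_def)
qed

text \<open>The maps that share a witness \<open>\<omega>\<close> agree on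
  \<open>S \<omega>\<close>, so it serves at most \<open>N ^ (card V - t)\<close> of the
  \<open>N ^ card V\<close> maps.\<close>

lemma card_PiE_le_witnesses:
  assumes "finite V" "finite W" and C: "\<And>i. i \<in> V \<Longrightarrow> finite (C i) \<and> card (C i) = N"
    and N: "1 \<le> N"
    and wit: "\<And>a. a \<in> PiE V C \<Longrightarrow> \<exists>\<omega>\<in>W. R a \<omega>"
    and S: "\<And>\<omega> a. a \<in> PiE V C \<Longrightarrow> R a \<omega> \<Longrightarrow> S \<omega> \<subseteq> V \<and> t \<le> card (S \<omega>)"
    and agree: "\<And>a b \<omega> i. a \<in> PiE V C \<Longrightarrow> b \<in> PiE V C \<Longrightarrow> R a \<omega> \<Longrightarrow> R b \<omega> \<Longrightarrow> i \<in> S \<omega> \<Longrightarrow> a i = b i"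
  shows "N ^ t \<le> card W"
proof -
  let ?K = "\<lambda>\<omega>. {a \<in> PiE V C. R a \<omega>}"
  have finP: "finite (PiE V C)" using assms(1) C by (auto intro: finite_PiE)
  have cardP: "card (PiE V C) = N ^ card V" using assms(1) C by (simp add: card_PiE)
  then have "PiE V C \<noteq> {}" using N by auto
  then obtain a \<omega> where "a \<in> PiE V C" "R a \<omega>" using wit by blast
  then have tV: "t \<le> card V" using S[of a \<omega>] card_mono[OF assms(1), of "S \<omega>"] by auto
  have K: "card (?K \<omega>) \<le> N ^ (card V - t)" for \<omega>
  proof (cases "?K \<omega> = {}")
    case True
    then show ?thesis by (simp only: card.empty)
  next
    case False
    then have S': "S \<omega> \<subseteq> V" "t \<le> card (S \<omega>)" using S by blast+
    have "card (?K \<omega>) \<le> (\<Prod>i\<in>V - S \<omega>. card (C i))"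
      by (rule card_PiE_agree_le) (use assms(1) C agree in auto)
    also have "\<dots> = N ^ card (V - S \<omega>)" using C by simp
    also have "\<dots> \<le> N ^ (card V - t)"
      using N S' assms(1) by (intro power_increasing) (auto simp: card_Diff_subset finite_subset)
    finally show ?thesis .
  qed
  have "PiE V C \<subseteq> (\<Union>\<omega>\<in>W. ?K \<omega>)" using wit by blast
  then have "card (PiE V C) \<le> card (\<Union>\<omega>\<in>W. ?K \<omega>)"
    using finP assms(2) by (intro card_mono) auto
  also have "\<dots> \<le> (\<Sum>\<omega>\<in>W. card (?K \<omega>))" using assms(2) by (rule card_UN_le)
  also have "\<dots> \<le> card W * N ^ (card V - t)"
    using sum_bounded_above[of W "\<lambda>\<omega>. card (?K \<omega>)"] K by simp
  finally have "N ^ t * N ^ (card V - t) \<le> card W * N ^ (card V - t)"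
    using cardP tV by (simp flip: power_add)
  then show ?thesis using N by simp
qed

section \<open>Colour-preserving maps and the exchange argument\<close>

text \<open>Disjointness makes every map in \<open>PiE V C\<close> injective. \<open>cover\<close>
  excludes isolated vertices, so that the monomial of a map shows its whole image.\<close>

locale colour_classes =
  fixes V :: "'a set" and E :: "'a set set" and C :: "'a \<Rightarrow> nat set" and n :: nat
  assumes finite_V: "finite V" and simple: "simple_graph V E" and cover: "\<Union>E = V"
    and classes: "i \<in> V \<Longrightarrow> C i \<subseteq> {1..n}"
    and disjoint: "i \<in> V \<Longrightarrow> j \<in> V \<Longrightarrow> i \<noteq> j \<Longrightarrow> C i \<inter> C j = {}"
begin

lemma finite_E: "finite E"
  using finite_V cover by (metis finite_UnionD)

lemma inj_on_colouring:
  assumes "\<And>i. i \<in> V \<Longrightarrow> a i \<in> C i" shows "inj_on a V"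
proof (rule inj_onI, rule ccontr)
  fix i j assume ij: "i \<in> V" "j \<in> V" "a i = a j" "i \<noteq> j"
  then show False using assms[of i] assms[of j] disjoint[of i j] by auto
qed

lemma inj_on_image_edges:
  assumes "a \<in> PiE V C" shows "inj_on (\<lambda>e. a ` e) E"
proof -
  have "inj_on a V" using assms by (intro inj_on_colouring) auto
  then have "inj_on (\<lambda>e. a ` e) (Pow V)" by (rule inj_on_image_Pow)
  then show ?thesis by (rule inj_on_subset) (use simple in \<open>auto simp: simple_graph_def\<close>)
qed

lemma edge_monomial_in_hom_poly:
  assumes a: "a \<in> PiE V C" shows "edge_monomial a E \<in> keys (hom_poly V E n)"
proof -
  have inj: "inj_on a V" using a by (intro inj_on_colouring) auto
  have V: "a \<in> V \<rightarrow>\<^sub>E {1..n}" using a classes by (auto simp: PiE_iff subset_iff)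
  have "{a i, a j} \<in> complete_edges {1..n}" if "{i, j} \<in> E" for i j
  proof -
    have ij: "i \<in> V" "j \<in> V" "i \<noteq> j" using that simple by (fastforce simp: simple_graph_def)+
    then have "a i \<noteq> a j" using inj by (auto dest: inj_onD)
    then show ?thesis using V ij by (auto simp: complete_edges_def PiE_iff)
  qed
  then show ?thesis
    using V by (auto simp: keys_hom_poly[OF finite_V finite_E] graph_homs_def)
qed

lemma occurs_boundary_agree:
  assumes a: "a \<in> PiE V C" and b: "b \<in> PiE V C"
    and occ_a: "occurs E (hom_poly V E n) a A p" and occ_b: "occurs E (hom_poly V E n) b A p"
    and i: "i \<in> boundary E A"
  shows "a i = b i"
proof (rule ccontr)
  assume ne: "a i \<noteq> b i"
  have A: "A \<subseteq> E" "finite A" "finite (E - A)"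
    using occ_a finite_E by (auto simp: occurs_def intro: finite_subset)
  have "edge_monomial a (E - A) + edge_monomial b A \<in> keys (hom_poly V E n)"
    using occ_a occ_b by (auto simp: occurs_def)
  \<comment> \<open>\<open>\<phi>\<close> need not respect the colours; only the size of its image
    will matter.\<close>
  then obtain \<phi> where \<phi>: "edge_monomial a (E - A) + edge_monomial b A = edge_monomial \<phi> E"
    by (auto simp: keys_hom_poly[OF finite_V finite_E])
  have "keys (edge_monomial a (E - A) + edge_monomial b A) =
      keys (edge_monomial a (E - A)) \<union> keys (edge_monomial b A)"
    by (auto simp: in_keys_iff lookup_add)
  then have "(\<lambda>e. \<phi> ` e) ` E = (\<lambda>e. a ` e) ` (E - A) \<union> (\<lambda>e. b ` e) ` A"
    using A finite_E unfolding \<phi> by (simp add: keys_edge_monomial)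
  then have "\<Union>((\<lambda>e. \<phi> ` e) ` E) = \<Union>((\<lambda>e. a ` e) ` (E - A) \<union> (\<lambda>e. b ` e) ` A)" by simp
  then have im: "\<phi> ` V = a ` \<Union>(E - A) \<union> b ` \<Union>A"
    by (simp add: image_Union[symmetric] Union_Un_distrib cover)
  \<comment> \<open>\<open>g\<close> selects one vertex touched by the mixed monomial from each
    class. As \<open>a i\<close> differs from \<open>b i\<close>, it is a second touched vertex in
    the class of \<open>i\<close>, one more than the image of \<open>\<phi>\<close> can
    hold.\<close>
  define g where "g = (\<lambda>j. if j \<in> \<Union>A then b j else a j)"
  have gC: "g j \<in> C j" if "j \<in> V" for j using a b that by (auto simp: g_def)
  have iV: "i \<in> V" and iA: "i \<in> \<Union>A" and iE: "i \<in> \<Union>(E - A)"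
    using i cover A by (auto simp: boundary_def)
  have "a i \<notin> g ` V"
  proof
    assume "a i \<in> g ` V"
    then obtain j where j: "j \<in> V" "a i = g j" by blast
    have "a i \<in> C i" using a iV by auto
    then have "j = i" using gC[OF j(1)] j disjoint[OF j(1) iV] by auto
    then show False using j ne iA by (simp add: g_def)
  qed
  then have "card (insert (a i) (g ` V)) = Suc (card V)"
    using finite_V inj_on_colouring[OF gC] by (simp add: card_image)
  moreover have "insert (a i) (g ` V) \<subseteq> \<phi> ` V"
  proof -
    have "g j \<in> \<phi> ` V" if "j \<in> V" for j
    proof (cases "j \<in> \<Union>A")
      case True
      then show ?thesis by (simp only: im g_def if_True) blast
    next
      case False
      then have "j \<in> \<Union>(E - A)" using that cover by auto
      then show ?thesis unfolding im using False by (auto simp: g_def)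
    qed
    moreover have "a i \<in> \<phi> ` V" using iE unfolding im by blast
    ultimately show ?thesis by blast
  qed
  then have "card (insert (a i) (g ` V)) \<le> card (\<phi> ` V)"
    using finite_V by (intro card_mono) auto
  then have "card (insert (a i) (g ` V)) \<le> card V"
    using card_image_le[OF finite_V, of \<phi>] by linarith
  ultimately show False by simp
qed

end

text \<open>The colour of an image vertex reveals its preimage. This settles the witnesses at input
  gates, whose bag is an edge.\<close>

lemma edge_image_eq_imp_agree:
  fixes a b :: "'a \<Rightarrow> nat"
  assumes "colour_classes V E C n" "a \<in> PiE V C" "b \<in> PiE V C" "e \<in> E" "a ` e = b ` e" "i \<in> e"
  shows "a i = b i"
proof -
  interpret colour_classes V E C n by fact
  have "a i \<in> b ` e" using assms by blast
  then obtain j where j: "j \<in> e" "a i = b j" by auto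
  have "i \<in> V" "j \<in> V" using assms j simple by (auto simp: simple_graph_def)
  moreover from this have "a i \<in> C i" "b j \<in> C j" using assms by auto
  ultimately have "j = i" using j disjoint[of i j] by auto
  then show ?thesis using j by simp
qed

section \<open>Tracing a monomial through a circuit\<close>

lemma finite_digraph_wf:
  assumes "fin_digraph G" "acyclic (arcs_ends G)" shows "wf (arcs_ends G)"
proof -
  interpret fin_digraph G by fact
  show ?thesis using assms(2) by (intro finite_acyclic_wf) (simp_all add: arcs_ends_conv)
qed

lemma monotone_circuit_nonneg:
  assumes C: "circuit X C" "monotone_circuit C"
    and val: "\<And>v. v \<in> verts (circ_dag C) \<Longrightarrow> val v = gate_value C val v"
    and v: "v \<in> verts (circ_dag C)"
  shows "nonneg_poly (val v)"
proof -
  define G where "G = circ_dag C"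
  interpret fin_digraph G using C by (simp add: circuit_def G_def)
  have "wf (arcs_ends G)"
    using C fin_digraph by (intro finite_digraph_wf) (auto simp: circuit_def G_def)
  then have "v \<in> verts G \<longrightarrow> nonneg_poly (val v)"
  proof (induction v rule: wf_induct_rule)
    case (less v)
    have tails: "nonneg_poly (val (tail G x))" if "x \<in> in_arcs G v" for x
      using less that by (auto simp: in_arcs_def arcs_ends_conv)
    show ?case
    proof
      assume v: "v \<in> verts G"
      then have eq: "val v = gate_value C val v" using val by (simp add: G_def)
      have c: "0 \<le> c" if "circ_gate C v = Const c" for c
        using C(2) v that by (auto simp: monotone_circuit_def G_def)
      show "nonneg_poly (val v)"
        unfolding eq gate_value_def G_def[symmetric]
        using tails c
        by (auto simp: poly_var_def poly_const_def nonneg_poly_single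
            intro!: nonneg_poly_sum nonneg_poly_prod split: gate.split)
    qed
  qed
  then show ?thesis using v by (simp add: G_def)
qed

text \<open>
  Arcs are natural numbers, and the factors of a product gate are split off in increasing order,
  which turns a product of unbounded fan-in into binary products, one per arc.
\<close>

definition later_factors :: "'v circuit \<Rightarrow> (nat \<Rightarrow> 'v qpoly) \<Rightarrow> nat \<Rightarrow> 'v qpoly" where
  "later_factors C val x =
     (\<Prod>y\<in>{y \<in> in_arcs (circ_dag C) (head (circ_dag C) x). x < y}. val (tail (circ_dag C) y))"

lemma edge_monomial_eq_0: "finite A \<Longrightarrow> edge_monomial a A = 0 \<Longrightarrow> A = {}"
  using keys_edge_monomial[of A a] by simp

text \<open>Used by contraposition: \<open>times\<close> and \<open>leaf\<close> say that no bag met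
  while tracing \<open>a\<close> exceeds \<open>w\<close>, so if the conclusion fails, some bag is
  larger, and it becomes the witness of \<open>a\<close>.\<close>

lemma occurs_branch_decomposable:
  assumes C: "circuit X C" "monotone_circuit C"
    and val: "\<And>v. v \<in> verts (circ_dag C) \<Longrightarrow> val v = gate_value C val v"
    and E: "finite E" "inj_on (\<lambda>e. a ` e) E"
    and times: "\<And>x A1 A2. x \<in> arcs (circ_dag C) \<Longrightarrow> occurs E P a A1 (val (tail (circ_dag C) x)) \<Longrightarrow>
      occurs E P a A2 (later_factors C val x) \<Longrightarrow> card (boundary E A1 \<union> boundary E A2) \<le> w"
    and leaf: "\<And>v e. v \<in> verts (circ_dag C) \<Longrightarrow> e \<in> E \<Longrightarrow> circ_gate C v = Var (a ` e) \<Longrightarrow> card e \<le> w"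
    and v: "v \<in> verts (circ_dag C)" "occurs E P a A (val v)"
  shows "branch_decomposable w E A"
proof -
  define G where "G = circ_dag C"
  interpret fin_digraph G using C by (simp add: circuit_def G_def)
  have nn: "nonneg_poly (val v)" if "v \<in> verts G" for v
    using monotone_circuit_nonneg[OF C val] that by (simp add: G_def)
  have "wf (arcs_ends G)"
    using C fin_digraph by (intro finite_digraph_wf) (auto simp: circuit_def G_def)
  then have "\<forall>A. v \<in> verts G \<longrightarrow> occurs E P a A (val v) \<longrightarrow> branch_decomposable w E A"
  proof (induction v rule: wf_induct_rule)
    case (less v)
    show ?case
    proof (intro allI impI)
      fix A assume v: "v \<in> verts G" and occ: "occurs E P a A (val v)"
      have A: "A \<subseteq> E" "finite A" using occ E by (auto simp: occurs_def intro: finite_subset)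
      have eq: "val v = gate_value C val v" using val v by (simp add: G_def)
      have IH: "branch_decomposable w E A'"
        if "x \<in> in_arcs G v" "occurs E P a A' (val (tail G x))" for x A'
      proof -
        have "(tail G x, v) \<in> arcs_ends G" "tail G x \<in> verts G"
          using that(1) by (auto simp: in_arcs_def arcs_ends_conv)
        then show ?thesis using less that(2) by blast
      qed
      have tails: "nonneg_poly (val (tail G x))" if "x \<in> in_arcs G v" for x
        using nn that by (auto simp: in_arcs_def)
      have fin_in: "finite (in_arcs G v)"
        by (rule finite_subset[OF _ finite_arcs]) (auto simp: in_arcs_def)
      show "branch_decomposable w E A"
      proof (cases "circ_gate C v")
        case (Var x)
        then have "edge_monomial a A = Poly_Mapping.single x 1"
          using occ eq by (simp add: occurs_def gate_value_def poly_var_def)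
        then have im: "(\<lambda>e. a ` e) ` A = {x}" using keys_edge_monomial[OF A(2), of a] by simp
        then have "x \<in> (\<lambda>e. a ` e) ` A" by (simp only: insertI1)
        then obtain e where e: "e \<in> A" "x = a ` e" by (rule imageE)
        have "e' = e" if "e' \<in> A" for e'
        proof -
          have "a ` e' = a ` e" using im that e(2) by (metis imageI singletonD)
          then show ?thesis using inj_onD[OF E(2)] that e(1) A(1) by (metis subsetD)
        qed
        then have "A = {e}" using e by blast
        moreover have "card e \<le> w" using leaf[of v e] v e A Var by (auto simp: G_def)
        ultimately show ?thesis using A by (auto intro: branch_decomposable.single)
      next
        case (Const c)
        then have "edge_monomial a A = 0"
          using occ eq by (auto simp: occurs_def gate_value_def poly_const_def split: if_splits)
        then have "A = {}" by (rule edge_monomial_eq_0[OF A(2)])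
        then show ?thesis by (simp add: branch_decomposable.empty)
      next
        case Plus
        then have "val v = (\<Sum>x\<in>in_arcs G v. val (tail G x))"
          using eq by (simp add: gate_value_def G_def)
        then have "\<exists>x\<in>in_arcs G v. occurs E P a A (val (tail G x))"
          using occ tails fin_in by (intro occurs_sum) simp_all
        then show ?thesis using IH by blast
      next
        case Times
        \<comment> \<open>The induction runs over upward closed sets \<open>T\<close> of incoming
          arcs: what remains after splitting off the least arc \<open>x\<close> is then exactly
          \<open>later_factors C val x\<close>.\<close>
        have "T \<subseteq> in_arcs G v \<longrightarrow> (\<forall>x\<in>T. \<forall>y\<in>in_arcs G v. x < y \<longrightarrow> y \<in> T) \<longrightarrow>
            (\<forall>A. occurs E P a A (\<Prod>x\<in>T. val (tail G x)) \<longrightarrow> branch_decomposable w E A)"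
          if "finite T" for T
          using that
        proof (induction T rule: finite_linorder_min_induct)
          case empty
          have "A = {}" if "occurs E P a A 1" for A
          proof -
            have "finite A" "edge_monomial a A = 0"
              using that E by (auto simp: occurs_def intro: finite_subset)
            then show ?thesis by (rule edge_monomial_eq_0)
          qed
          then show ?case by (auto intro: branch_decomposable.empty)
        next
          case (insert x T)
          show ?case
          proof (intro impI allI)
            fix A
            assume sub: "insert x T \<subseteq> in_arcs G v"
              and up: "\<forall>z\<in>insert x T. \<forall>y\<in>in_arcs G v. z < y \<longrightarrow> y \<in> insert x T"
              and occ: "occurs E P a A (\<Prod>x\<in>insert x T. val (tail G x))"
            have hx: "head G x = v" "x \<in> arcs G" using sub by auto
            have T: "T = {y \<in> in_arcs G v. x < y}" using insert.hyps(2) sub up by auto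
            have notin: "x \<notin> T" using insert.hyps(2) by auto
            have later: "later_factors C val x = (\<Prod>x\<in>T. val (tail G x))"
              unfolding later_factors_def G_def[symmetric] hx(1) T ..
            have nnT: "nonneg_poly (\<Prod>x\<in>T. val (tail G x))"
              using tails sub by (intro nonneg_poly_prod) auto
            have "occurs E P a A (val (tail G x) * (\<Prod>x\<in>T. val (tail G x)))"
              using occ insert.hyps(1) notin by simp
            from occurs_mult[OF this tails nnT E]
            obtain A1 A2 where A12: "A1 \<union> A2 = A" "A1 \<inter> A2 = {}"
                "occurs E P a A1 (val (tail G x))" "occurs E P a A2 (\<Prod>x\<in>T. val (tail G x))"
              using sub by auto
            have "branch_decomposable w E A1" using IH A12(3) sub by blast
            moreover have "\<forall>z\<in>T. \<forall>y\<in>in_arcs G v. z < y \<longrightarrow> y \<in> T"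
              using T by auto
            then have "branch_decomposable w E A2" using insert.IH A12(4) sub by blast
            moreover have "card (boundary E A1 \<union> boundary E A2) \<le> w"
              using times[of x A1 A2] A12 hx later by (simp add: G_def)
            ultimately show "branch_decomposable w E A"
              using A12 branch_decomposable.union by metis
          qed
        qed
        from this[OF fin_in] show ?thesis
          using Times eq occ by (simp add: gate_value_def G_def[symmetric])
      qed
    qed
  qed
  then show ?thesis using v by (simp add: G_def)
qed

lemma hom_poly_lower_bound:
  fixes Cl :: "'a \<Rightarrow> nat set"
  assumes cc: "colour_classes V E Cl n" and N: "1 \<le> N" "\<And>i. i \<in> V \<Longrightarrow> card (Cl i) = N"
    and C: "circuit X C" "monotone_circuit C" "computes C (hom_poly V E n)"
    and tw: "1 \<le> treewidth V E"
  shows "N ^ (treewidth V E + 1) \<le> (circuit_size C + 1) * (4 ^ card E + card E)"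
proof -
  interpret colour_classes V E Cl n by fact
  define G where "G = circ_dag C"
  interpret G: fin_digraph G using C by (simp add: circuit_def G_def)
  define P where "P = hom_poly V E n"
  define w where "w = treewidth V E"
  obtain val where val: "\<And>v. v \<in> verts G \<Longrightarrow> val v = gate_value C val v" "val (circ_root C) = P"
    using C(3) by (auto simp: computes_def G_def P_def)
  \<comment> \<open>A witness names a bag: an arc with the edge sets of its two factors, or an input
    gate with the edge it stands for. As edges have two elements, the second kind is large enough
    only when \<open>w\<close> is 1.\<close>
  define W :: "(nat \<times> 'a set set \<times> 'a set set + nat \<times> 'a set) set"
    where "W = (arcs G \<times> Pow E \<times> Pow E) <+> (verts G \<times> E)"
  define S :: "nat \<times> 'a set set \<times> 'a set set + nat \<times> 'a set \<Rightarrow> 'a set"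
    where "S = case_sum (\<lambda>(x, A1, A2). boundary E A1 \<union> boundary E A2) (\<lambda>(v, e). e)"
  define R where "R = (\<lambda>a \<omega>. \<omega> \<in> W \<and> w < card (S \<omega>) \<and> (case \<omega> of
      Inl (x, A1, A2) \<Rightarrow> occurs E P a A1 (val (tail G x)) \<and> occurs E P a A2 (later_factors C val x)
    | Inr (v, e) \<Rightarrow> circ_gate C v = Var (a ` e)))"
  have "N ^ (w + 1) \<le> card W"
  proof (rule card_PiE_le_witnesses[of V W Cl N R S])
    show "finite W" using finite_E by (auto simp: W_def)
    show "finite (Cl i) \<and> card (Cl i) = N" if "i \<in> V" for i
      using classes[OF that] N that finite_subset by auto
  next
    fix a assume a: "a \<in> PiE V Cl"
    show "\<exists>\<omega>\<in>W. R a \<omega>"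
    proof (rule ccontr)
      assume no: "\<not> (\<exists>\<omega>\<in>W. R a \<omega>)"
      have "branch_decomposable w E E"
      proof (rule occurs_branch_decomposable[OF C(1,2) _ finite_E inj_on_image_edges[OF a],
            of val P w "circ_root C"])
        fix x A1 A2
        assume h: "x \<in> arcs (circ_dag C)" "occurs E P a A1 (val (tail (circ_dag C) x))"
          "occurs E P a A2 (later_factors C val x)"
        then have "Inl (x, A1, A2) \<in> W" by (auto simp: W_def G_def occurs_def)
        then have "\<not> R a (Inl (x, A1, A2))" using no by blast
        with h \<open>Inl (x, A1, A2) \<in> W\<close> show "card (boundary E A1 \<union> boundary E A2) \<le> w"
          by (auto simp: R_def S_def G_def)
      next
        fix v e assume h: "v \<in> verts (circ_dag C)" "e \<in> E" "circ_gate C v = Var (a ` e)"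
        then have "Inr (v, e) \<in> W" by (auto simp: W_def G_def)
        then have "\<not> R a (Inr (v, e))" using no by blast
        with h \<open>Inr (v, e) \<in> W\<close> show "card e \<le> w" by (auto simp: R_def S_def)
      next
        show "circ_root C \<in> verts (circ_dag C)" using C(1) by (simp add: circuit_def)
        show "occurs E P a E (val (circ_root C))"
          using edge_monomial_in_hom_poly[OF a]
          by (simp add: val occurs_def P_def edge_monomial_def)
      qed (use val in \<open>simp_all add: G_def\<close>)
      \<comment> \<open>All bags would have at most \<open>w\<close> vertices. Since
        \<open>w\<close> is at least 1, the subtraction does not truncate and this contradicts the
        choice of \<open>w\<close>.\<close>
      then have "treewidth V E \<le> w - 1" using cover by (rule branch_decomposable_treewidth_le)
      then show False using tw by (simp add: w_def)
    qed
  next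
    fix \<omega> a assume R: "R a \<omega>"
    have "S \<omega> \<subseteq> \<Union>E"
      using R by (cases \<omega>) (auto simp: R_def S_def W_def boundary_def)
    then show "S \<omega> \<subseteq> V \<and> w + 1 \<le> card (S \<omega>)" using R cover by (auto simp: R_def)
  next
    fix a b \<omega> i
    assume ab: "a \<in> PiE V Cl" "b \<in> PiE V Cl" and R: "R a \<omega>" "R b \<omega>" and i: "i \<in> S \<omega>"
    show "a i = b i"
    proof (cases \<omega>)
      case (Inl l)
      obtain x A1 A2 where l: "l = (x, A1, A2)" by (cases l) auto
      then have "i \<in> boundary E A1 \<or> i \<in> boundary E A2" using i Inl by (auto simp: S_def)
      then show ?thesis
        using occurs_boundary_agree[OF ab] R Inl l unfolding R_def P_def by auto
    next
      case (Inr r)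
      obtain v e where r: "r = (v, e)" by (cases r)
      then have "a ` e = b ` e" "e \<in> E" "i \<in> e" using R i Inr by (auto simp: R_def S_def W_def)
      then show ?thesis using edge_image_eq_imp_agree[OF cc ab] by blast
    qed
  qed (use finite_V N in auto)
  also have "card W = card (arcs G) * (2 ^ card E * 2 ^ card E) + card (verts G) * card E"
    unfolding W_def using finite_E by (simp add: card_Plus card_cartesian_product card_Pow)
  also have "(2::nat) ^ card E * 2 ^ card E = 4 ^ card E"
    by (simp flip: power_mult_distrib)
  also have "card (arcs G) * 4 ^ card E + card (verts G) * card E \<le>
      (card (arcs G) + 1) * 4 ^ card E + (card (arcs G) + 1) * card E"
    using card_verts_le[OF C(1)] by (intro add_mono mult_right_mono) (auto simp: G_def)
  finally show ?thesis by (simp add: w_def circuit_size_def G_def distrib_left)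
qed

section \<open>Parameters and asymptotics\<close>

text \<open>The decomposition with the single bag \<open>V\<close> shows that the
  \<open>LEAST\<close> defining treewidth ranges over a nonempty set.\<close>

lemma treewidth_attained:
  assumes "finite V" "simple_graph V E"
  obtains B F where "tree_decomposition V E B F" "\<And>b. b \<in> B \<Longrightarrow> card b \<le> treewidth V E + 1"
proof -
  have "\<exists>b\<in>{V}. e \<subseteq> b" if "e \<in> E" for e using assms(2) that by (auto simp: simple_graph_def)
  then have "\<exists>F. tree_decomposition V E {V} F"
    by (intro rip_imp_tree_decomposition rip_single) auto
  then have "\<exists>w B F. tree_decomposition V E B F \<and> w = decomposition_width B" by blast
  then have "\<exists>B F. tree_decomposition V E B F \<and> treewidth V E = decomposition_width B"
    unfolding treewidth_def by (rule LeastI_ex)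
  then obtain B F where td: "tree_decomposition V E B F" "treewidth V E = decomposition_width B"
    by blast
  have fin: "finite B" using rip_finite[OF tree_decomposition_imp_rip[OF td(1) assms(1)]] .
  have "card b \<le> treewidth V E + 1" if "b \<in> B" for b
  proof -
    have "card b \<le> Max (card ` B)" using fin that by (intro Max_ge) auto
    then show ?thesis unfolding td(2) decomposition_width_def by linarith
  qed
  then show ?thesis using that td(1) by blast
qed

lemma treewidth_ge_1:
  assumes "finite V" "simple_graph V E" "e \<in> E"
  shows "1 \<le> treewidth V E"
proof -
  obtain B F where td: "tree_decomposition V E B F"
    and le: "\<And>b. b \<in> B \<Longrightarrow> card b \<le> treewidth V E + 1"
    using treewidth_attained[OF assms(1,2)] by blast
  have "\<exists>b\<in>B. e \<subseteq> b" using td assms(3) by (simp add: tree_decomposition_def)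
  then obtain b where b: "b \<in> B" "e \<subseteq> b" by (rule bexE)
  have "b \<subseteq> V" using td b(1) by (simp add: tree_decomposition_def)
  have "card e = 2" using assms by (auto simp: simple_graph_def)
  moreover have "card e \<le> card b"
    using b(2) finite_subset[OF \<open>b \<subseteq> V\<close> assms(1)] by (rule card_mono[rotated])
  ultimately show ?thesis using le[OF b(1)] by linarith
qed

lemma connected_graph_Union_edges:
  assumes "simple_graph V E" "connected_graph V E" "u \<in> V" "v \<in> V" "u \<noteq> v"
  shows "\<Union>E = V"
proof
  show "\<Union>E \<subseteq> V" using assms(1) by (auto simp: simple_graph_def)
  show "V \<subseteq> \<Union>E"
  proof
    fix i assume "i \<in> V"
    obtain j where "j \<in> V" "j \<noteq> i" using assms by metis
    with \<open>i \<in> V\<close> have "(i, j) \<in> (adj E)\<^sup>*" using assms(2) by (auto simp: connected_graph_def)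
    then show "i \<in> \<Union>E"
    proof (cases rule: converse_rtranclE)
      case base
      then show ?thesis using \<open>j \<noteq> i\<close> by simp
    next
      case (step y)
      then show ?thesis by blast
    qed
  qed
qed

text \<open>The classes are the residue classes modulo \<open>k\<close>, cut off at
  \<open>k * (n div k)\<close> so that all have the same size.\<close>

lemma residue_colour_classes:
  assumes "simple_graph {1..k} E" "\<Union>E = {1..k}"
  shows "colour_classes {1..k} E (\<lambda>i. (\<lambda>t. k * t + i) ` {..<n div k}) n"
proof
  fix i assume i: "i \<in> {1..k}"
  show "(\<lambda>t. k * t + i) ` {..<n div k} \<subseteq> {1..n}"
  proof
    fix u assume "u \<in> (\<lambda>t. k * t + i) ` {..<n div k}"
    then obtain t where t: "t < n div k" "u = k * t + i" by auto
    then have "k * (t + 1) \<le> k * (n div k)" by (intro mult_le_mono2) simp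
    also have "\<dots> \<le> n" by simp
    finally show "u \<in> {1..n}" using t i by auto
  qed
  fix j assume j: "j \<in> {1..k}" and ne: "i \<noteq> j"
  have False if "k * t + i = k * t' + j" for t t'
  proof -
    \<comment> \<open>The shift by 1 turns the colours \<open>1, ..., k\<close> into the residues
      \<open>0, ..., k - 1\<close>.\<close>
    have "k * t + (i - 1) = k * t' + (j - 1)" using that i j by simp
    then have "(k * t + (i - 1)) mod k = (k * t' + (j - 1)) mod k" by simp
    then have "i - 1 = j - 1" using i j by (simp add: less_eq_Suc_le)
    then show False using i j ne by auto
  qed
  then show "(\<lambda>t. k * t + i) ` {..<n div k} \<inter> (\<lambda>t. k * t + j) ` {..<n div k} = {}" by blast
qed (use assms in auto)

text \<open>For \<open>k = 1\<close> the polynomial is the constant \<open>n\<close>, which a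
  circuit without arcs computes, and the lower bound would fail.\<close>

theorem theorem1:
  fixes k :: nat and E :: "nat set set"
  assumes "2 \<le> k"
    and "simple_graph {1..k} E"
    and "connected_graph {1..k} E"
  shows "(\<lambda>n. real (min_monotone_size (complete_edges {1..n}) (hom_poly {1..k} E n)))
           \<in> \<Theta>(\<lambda>n. real n ^ (treewidth {1..k} E + 1))"
proof -
  define s where "s n = min_monotone_size (complete_edges {1..n}) (hom_poly {1..k} E n)" for n
  define t where "t = treewidth {1..k} E + 1"
  have cover: "\<Union>E = {1..k}"
    by (rule connected_graph_Union_edges[OF assms(2,3), of 1 2]) (use assms(1) in auto)
  then obtain e where "e \<in> E" using assms(1) by fastforce
  then have tw: "1 \<le> treewidth {1..k} E" using treewidth_ge_1[OF _ assms(2)] by simp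
  obtain B F where td: "tree_decomposition {1..k} E B F" and B: "\<And>b. b \<in> B \<Longrightarrow> card b \<le> t"
    using treewidth_attained[OF _ assms(2)] unfolding t_def by blast
  define K where "K = card B * (card E + 3)"
  have upper: "\<exists>C. circuit (complete_edges {1..n}) C \<and> monotone_circuit C \<and>
      computes C (hom_poly {1..k} E n) \<and> circuit_size C \<le> K * n ^ t" if "1 \<le> n" for n
    unfolding K_def using hom_poly_upper_bound[OF _ assms(2) td B that] by simp
  have s_le: "s n \<le> K * n ^ t" if n: "1 \<le> n" for n
  proof -
    obtain C where C: "circuit (complete_edges {1..n}) C" "monotone_circuit C"
        "computes C (hom_poly {1..k} E n)" "circuit_size C \<le> K * n ^ t"
      using upper[OF n] by blast
    then have "s n \<le> circuit_size C"
      unfolding s_def min_monotone_size_def by (intro Least_le) blast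
    then show ?thesis using C(4) by simp
  qed
  define L where "L = 4 ^ card E + card E"
  \<comment> \<open>The threshold gives \<open>L + 1 \<le> N\<close>. This excludes
    \<open>s n = 0\<close>, for which the lower bound would say \<open>N ^ t \<le> L\<close>, and so
    \<open>s n + 1\<close> can be replaced by \<open>2 * s n\<close>. The factor
    \<open>2 * k\<close> comes from \<open>n \<le> 2 * k * N\<close>.\<close>
  have le_s: "n ^ t \<le> (2 * k) ^ t * (2 * L) * s n" if n: "k * (L + 1) \<le> n" for n
  proof -
    have "1 \<le> k * (L + 1)" using assms(1) by simp
    then have "1 \<le> n" using n by linarith
    from upper[OF this]
    have "\<exists>m C. circuit (complete_edges {1..n}) C \<and> monotone_circuit C \<and>
        computes C (hom_poly {1..k} E n) \<and> circuit_size C = m" by blast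
    from LeastI_ex[OF this] obtain C where C: "circuit (complete_edges {1..n}) C"
        "monotone_circuit C" "computes C (hom_poly {1..k} E n)" "circuit_size C = s n"
      unfolding s_def min_monotone_size_def by blast
    define N where "N = n div k"
    have N: "L + 1 \<le> N"
      using div_le_mono[OF n, of k] assms(1) by (simp add: N_def)
    have "card ((\<lambda>t. k * t + i) ` {..<n div k}) = N" for i
      using assms(1) by (simp add: card_image inj_on_def N_def)
    then have Nt: "N ^ t \<le> (s n + 1) * L"
      unfolding t_def L_def C(4)[symmetric]
      using hom_poly_lower_bound[OF residue_colour_classes[OF assms(2) cover, of n] _ _ C(1-3) tw,
          of N] N
      by simp
    have "s n \<noteq> 0"
    proof
      assume "s n = 0"
      then have "N ^ t \<le> L" using Nt by simp
      moreover have "N \<le> N ^ t" using N by (intro self_le_power) (auto simp: t_def)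
      ultimately show False using N by linarith
    qed
    then have s2: "s n + 1 \<le> 2 * s n" by simp
    have "n \<le> k * N + k"
      using mult_div_mod_eq[of k n] mod_less_divisor[of k n] assms(1) unfolding N_def by linarith
    also have "\<dots> \<le> 2 * k * N" using N by (cases N) auto
    finally have "n ^ t \<le> (2 * k * N) ^ t" by (rule power_mono) simp
    also have "\<dots> = (2 * k) ^ t * N ^ t" by (simp add: power_mult_distrib)
    also have "\<dots> \<le> (2 * k) ^ t * ((s n + 1) * L)" using Nt by (rule mult_le_mono2)
    also have "\<dots> \<le> (2 * k) ^ t * ((2 * s n) * L)"
      using s2 by (intro mult_le_mono2 mult_le_mono1)
    finally show ?thesis by (simp add: ac_simps)
  qed
  have "(\<lambda>n. real (s n)) \<in> O(\<lambda>n. real n ^ t)"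
  proof (rule bigoI)
    show "eventually (\<lambda>n. norm (real (s n)) \<le> real K * norm (real n ^ t)) sequentially"
      using eventually_ge_at_top[of 1]
    proof eventually_elim
      case (elim n)
      then have "real (s n) \<le> real (K * n ^ t)" using s_le by (intro of_nat_mono) simp
      then show ?case by simp
    qed
  qed
  moreover have "(\<lambda>n. real n ^ t) \<in> O(\<lambda>n. real (s n))"
  proof (rule bigoI)
    show "eventually (\<lambda>n. norm (real n ^ t) \<le> real ((2 * k) ^ t * (2 * L)) * norm (real (s n)))
        sequentially"
      using eventually_ge_at_top[of "k * (L + 1)"]
    proof eventually_elim
      case (elim n)
      then have "real (n ^ t) \<le> real ((2 * k) ^ t * (2 * L) * s n)"
        using le_s by (intro of_nat_mono)
      then show ?case by simp
    qed
  qed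
  ultimately have "(\<lambda>n. real (s n)) \<in> \<Theta>(\<lambda>n. real n ^ t)"
    by (intro bigthetaI) (simp_all add: bigomega_iff_bigo)
  then show ?thesis by (simp add: s_def t_def)
qed

end
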